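(* Let $\mathbf{y}[k]\in\mathbb{R}^n$, $k\ge0$, be a stationary process that is $L$-mixing with respect to $(\mathcal{F},\mathcal{F}^+)$, and let $1\le K\le M$ be integers. For $k\ge1$ and $s\in\mathbb{R}$ define the batch estimator $$\hat{\boldsymbol{\Phi}}_k(s)=\frac1k\sum_{i=0}^{k-1}\big(\hat{\mathbf{y}}_i(s)-h(s)\hat{\boldsymbol{\mu}}_k\big)\big(\hat{\mathbf{y}}_i(s)-h(s)\hat{\boldsymbol{\mu}}_k\big)^\star,\qquad \hat{\boldsymbol{\mu}}_k=\frac1k\sum_{i=0}^{k-1}\bar{\mathbf{y}}_i.$$ Then for all integers $k\ge1$, all $s\in\mathbb{R}$, and all $q\ge1$, $$\big\|\hat{\boldsymbol{\Phi}}_k(s)-\bar{\Phi}(s)\big\|_{L_q}\le\Big(4\sqrt{6(2q-1)c_{1,2q}^3c_{2,2q}}+2c_{1,2q}c_{2q}+c_{2q}^2\Big)\frac{1}{\sqrt{k}},$$ where $c_{1,q}=4\sqrt{(2q-1)M_{2q}(\mathbf{y})\Gamma_{d,2q}(\mathbf{y})}$, $c_{2,q}=2\big(\lfloor\frac{M-1}{K}\rfloor+1\big)c_{1,q}+\big(\lfloor\frac{M-1}{K}\rfloor+1\big)\Gamma_{d,2q}(\mathbf{y})$, and $c_q=c_{1,q}\big(\lfloor\frac{M-1}{K}\rfloor+1\big)$ (each evaluated with $q$ replaced by $2q$ as indicated).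
   Context: Probability space with a monotone increasing family of $\sigma$-algebras $\mathcal{F}=(\mathcal{F}_k)_{k\ge0}$ and a monotone decreasing family $\mathcal{F}^+=(\mathcal{F}_k^+)_{k\ge0}$ such that $\mathcal{F}_k$ and $\mathcal{F}_k^+$ are independent for every $k$. For a random variable $\mathbf{x}$ in a finite-dimensional real or complex inner product space (Euclidean norm for vectors, Frobenius norm for matrices) and $q\ge1$, $\|\mathbf{x}\|_{L_q}=(\mathbb{E}\|\mathbf{x}\|^q)^{1/q}$. A process $(\mathbf{x}_k)_{k\ge0}$ is $L$-mixing with respect to $(\mathcal{F},\mathcal{F}^+)$ if: $\mathbf{x}_k$ is $\mathcal{F}_k$-measurable for all $k$; $M_q(\mathbf{x}):=\sup_{k\ge0}\|\mathbf{x}_k\|_{L_q}<\infty$ for all $q\ge1$; and $\Gamma_{d,q}(\mathbf{x}):=\sum_{\tau=0}^\infty\gamma_q(\tau,\mathbf{x})<\infty$ for all $q\ge1$, where $\gamma_q(\tau,\mathbf{x})=\sup_{k\ge\tau}\|\mathbf{x}_k-\mathbb{E}[\mathbf{x}_k\mid\mathcal{F}^+_{k-\tau}]\|_{L_q}$. Setup: $\mathbf{y}[k]\in\mathbb{R}^n$ is stationary with mean $\mu=\mathbb{E}[\mathbf{y}[k]]$. Fix integers $1\le K\le M$ and, for each $s\in\mathbb{R}$, complex weights $w_0(s),\dots,w_{M-1}(s)$ with $\sum_{k=0}^{M-1}|w_k(s)|^2=1$ (e.g. Bartlett: $K=M$, $w_k(s)=M^{-1/2}e^{-j2\pi ks}$;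 Welch: $w_k(s)=\frac{v_k}{\|v\|_2}e^{-j2\pi ks}$ for a fixed nonzero $v\in\mathbb{R}^M$). Define for $i\ge0$: $\bar{\mathbf{y}}_i=\frac1M\sum_{k=0}^{M-1}\mathbf{y}[iK+k]$, $\hat{\mathbf{y}}_i(s)=\sum_{k=0}^{M-1}w_k(s)\mathbf{y}[iK+k]$, $h(s)=\sum_{k=0}^{M-1}w_k(s)$, and $\bar{\Phi}(s)=\mathbb{E}\big[(\hat{\mathbf{y}}_i(s)-h(s)\mu)(\hat{\mathbf{y}}_i(s)-h(s)\mu)^\star\big]$ (independent of $i$ by stationarity); $\star$ denotes conjugate transpose. *)

theory Defs
  imports "HOL-Probability.Probability"
begin

text \<open>L_q norm of a random vector (Euclidean / Frobenius norm via the norm of the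
  vector type): (E norm(x)^q)^(1/q), with the Bochner integral.\<close>
definition Lq_norm :: "'a measure \<Rightarrow> real \<Rightarrow> ('a \<Rightarrow> 'b::real_normed_vector) \<Rightarrow> real" where
  "Lq_norm P q x = (\<integral>\<omega>. norm (x \<omega>) powr q \<partial>P) powr (1 / q)"

definition cond_exp_vec :: "'a measure \<Rightarrow> 'a measure \<Rightarrow> ('a \<Rightarrow> real ^ 'n) \<Rightarrow> ('a \<Rightarrow> real ^ 'n)" where
  "cond_exp_vec P G x = (\<lambda>\<omega>. \<chi> i. real_cond_exp P G (\<lambda>\<eta>. x \<eta> $ i) \<omega>)"

definition Mq :: "'a measure \<Rightarrow> real \<Rightarrow> (nat \<Rightarrow> 'a \<Rightarrow> real ^ 'n) \<Rightarrow> real" where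
  "Mq P q x = (SUP k. Lq_norm P q (x k))"

definition gamma_q :: "'a measure \<Rightarrow> (nat \<Rightarrow> 'a measure) \<Rightarrow> real \<Rightarrow> nat \<Rightarrow> (nat \<Rightarrow> 'a \<Rightarrow> real ^ 'n) \<Rightarrow> real" where
  "gamma_q P Fp q \<tau> x =
     (SUP k\<in>{\<tau>..}. Lq_norm P q (\<lambda>\<omega>. x k \<omega> - cond_exp_vec P (Fp (k - \<tau>)) (x k) \<omega>))"

definition Gamma_dq :: "'a measure \<Rightarrow> (nat \<Rightarrow> 'a measure) \<Rightarrow> real \<Rightarrow> (nat \<Rightarrow> 'a \<Rightarrow> real ^ 'n) \<Rightarrow> real" where
  "Gamma_dq P Fp q x = (\<Sum>\<tau>. gamma_q P Fp q \<tau> x)"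

definition filtration_pair :: "'a measure \<Rightarrow> (nat \<Rightarrow> 'a measure) \<Rightarrow> (nat \<Rightarrow> 'a measure) \<Rightarrow> bool" where
  "filtration_pair P F Fp \<longleftrightarrow>
     (\<forall>k. subalgebra P (F k) \<and> subalgebra P (Fp k)) \<and>
     (\<forall>k l. k \<le> l \<longrightarrow> sets (F k) \<subseteq> sets (F l)) \<and>
     (\<forall>k l. k \<le> l \<longrightarrow> sets (Fp l) \<subseteq> sets (Fp k)) \<and>
     (\<forall>k. prob_space.indep_set P (sets (F k)) (sets (Fp k)))"

definition L_mixing :: "'a measure \<Rightarrow> (nat \<Rightarrow> 'a measure) \<Rightarrow> (nat \<Rightarrow> 'a measure) \<Rightarrow> (nat \<Rightarrow> 'a \<Rightarrow> real ^ 'n) \<Rightarrow> bool" where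
  "L_mixing P F Fp x \<longleftrightarrow>
     (\<forall>k. x k \<in> borel_measurable (F k)) \<and>
     (\<forall>q\<ge>1. (\<forall>k. integrable P (\<lambda>\<omega>. norm (x k \<omega>) powr q)) \<and>
              bdd_above (range (\<lambda>k. Lq_norm P q (x k)))) \<and>
     (\<forall>q\<ge>1. summable (\<lambda>\<tau>. gamma_q P Fp q \<tau> x))"

definition stationary :: "'a measure \<Rightarrow> (nat \<Rightarrow> 'a \<Rightarrow> real ^ 'n) \<Rightarrow> bool" where
  "stationary P y \<longleftrightarrow>
     (\<forall>m. distr P (PiM UNIV (\<lambda>_. borel)) (\<lambda>\<omega> k. y (k + m) \<omega>) =
          distr P (PiM UNIV (\<lambda>_. borel)) (\<lambda>\<omega> k. y k \<omega>))"

definition cvec :: "real ^ 'n \<Rightarrow> complex ^ 'n" where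
  "cvec v = (\<chi> j. complex_of_real (v $ j))"

definition outer :: "complex ^ 'n \<Rightarrow> complex ^ 'n ^ 'n" where
  "outer u = (\<chi> i j. u $ i * cnj (u $ j))"

definition ybar :: "nat \<Rightarrow> nat \<Rightarrow> (nat \<Rightarrow> 'a \<Rightarrow> real ^ 'n) \<Rightarrow> nat \<Rightarrow> 'a \<Rightarrow> real ^ 'n" where
  "ybar K M y i \<omega> = (1 / real M) *\<^sub>R (\<Sum>k<M. y (i * K + k) \<omega>)"

definition yhat :: "nat \<Rightarrow> nat \<Rightarrow> (real \<Rightarrow> nat \<Rightarrow> complex) \<Rightarrow> (nat \<Rightarrow> 'a \<Rightarrow> real ^ 'n) \<Rightarrow> nat \<Rightarrow> real \<Rightarrow> 'a \<Rightarrow> complex ^ 'n" where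
  "yhat K M w y i s \<omega> = (\<Sum>k<M. w s k *s cvec (y (i * K + k) \<omega>))"

definition hfun :: "nat \<Rightarrow> (real \<Rightarrow> nat \<Rightarrow> complex) \<Rightarrow> real \<Rightarrow> complex" where
  "hfun M w s = (\<Sum>k<M. w s k)"

definition muhat :: "nat \<Rightarrow> nat \<Rightarrow> (nat \<Rightarrow> 'a \<Rightarrow> real ^ 'n) \<Rightarrow> nat \<Rightarrow> 'a \<Rightarrow> real ^ 'n" where
  "muhat K M y k \<omega> = (1 / real k) *\<^sub>R (\<Sum>i<k. ybar K M y i \<omega>)"

definition Phihat :: "nat \<Rightarrow> nat \<Rightarrow> (real \<Rightarrow> nat \<Rightarrow> complex) \<Rightarrow> (nat \<Rightarrow> 'a \<Rightarrow> real ^ 'n) \<Rightarrow> nat \<Rightarrow> real \<Rightarrow> 'a \<Rightarrow> complex ^ 'n ^ 'n" where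
  "Phihat K M w y k s \<omega> = (1 / real k) *\<^sub>R
     (\<Sum>i<k. outer (yhat K M w y i s \<omega> - hfun M w s *s cvec (muhat K M y k \<omega>)))"

text \<open>Bar Phi(s) = E[(yhat_i(s) - h(s) mu)(...)^*], taken at i = 0 (independent of i by stationarity).\<close>
definition Phibar :: "'a measure \<Rightarrow> nat \<Rightarrow> nat \<Rightarrow> (real \<Rightarrow> nat \<Rightarrow> complex) \<Rightarrow> (nat \<Rightarrow> 'a \<Rightarrow> real ^ 'n) \<Rightarrow> real \<Rightarrow> complex ^ 'n ^ 'n" where
  "Phibar P K M w y s =
     (\<integral>\<omega>. outer (yhat K M w y 0 s \<omega> - hfun M w s *s cvec (\<integral>\<eta>. y 0 \<eta> \<partial>P)) \<partial>P)"

definition c1 :: "'a measure \<Rightarrow> (nat \<Rightarrow> 'a measure) \<Rightarrow> (nat \<Rightarrow> 'a \<Rightarrow> real ^ 'n) \<Rightarrow> real \<Rightarrow> real" where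
  "c1 P Fp y q = 4 * sqrt ((2 * q - 1) * Mq P (2 * q) y * Gamma_dq P Fp (2 * q) y)"

definition c2 :: "'a measure \<Rightarrow> (nat \<Rightarrow> 'a measure) \<Rightarrow> nat \<Rightarrow> nat \<Rightarrow> (nat \<Rightarrow> 'a \<Rightarrow> real ^ 'n) \<Rightarrow> real \<Rightarrow> real" where
  "c2 P Fp K M y q = 2 * (real ((M - 1) div K) + 1) * c1 P Fp y q
                     + (real ((M - 1) div K) + 1) * Gamma_dq P Fp (2 * q) y"

definition cc :: "'a measure \<Rightarrow> (nat \<Rightarrow> 'a measure) \<Rightarrow> nat \<Rightarrow> nat \<Rightarrow> (nat \<Rightarrow> 'a \<Rightarrow> real ^ 'n) \<Rightarrow> real \<Rightarrow> real" where
  "cc P Fp K M y q = c1 P Fp y q * (real ((M - 1) div K) + 1)"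

end

theory Submission
  imports Defs
begin

text \<open>
  For \<open>p \<ge> 2\<close> the squared \<open>L\<^sub>p\<close> norm is convex and its derivative, the duality map
  \<open>X \<mapsto> 2 \<parallel>X\<parallel>\<^sup>2\<^sup>-\<^sup>p \<bar>X\<bar>\<^sup>p\<^sup>-\<^sup>2 X\<close>, is Lipschitz with constant \<open>6 (p - 1)\<close>. Let \<open>S\<^sub>n\<close> be the partial sums of a
  centred process \<open>\<xi>\<close>. Convexity bounds the increment of \<open>\<parallel>S\<^sub>n\<parallel>\<^sup>2\<close> by the derivative at the new
  partial sum applied to \<open>\<xi>\<^sub>n\<close>; telescoping this derivative along the past partial sums, and
  replacing \<open>\<xi>\<^sub>n\<close> in the \<open>j\<close>-th difference by its error against a centred variable measurable with
  respect to the \<open>j\<close>-th future \<open>\<sigma>\<close>-algebra (independent of the partial sums up to time \<open>j\<close>), gives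
  \<open>\<parallel>\<Sum> \<xi>\<^sub>n\<parallel>\<^sup>2 \<le> 6 (p - 1) m G \<Sum> a\<^sub>n\<^sup>2\<close> if \<open>\<parallel>\<xi>\<^sub>n\<parallel> \<le> a\<^sub>n m\<close> and the errors are at most \<open>a\<^sub>n g(n - j)\<close>
  with \<open>\<Sum> g \<le> G\<close>. Applied to weighted sums of the data this bounds the
  windowed transforms and the error of the mean estimate in \<open>L\<^sub>4\<^sub>q\<close>; applied in \<open>L\<^sub>2\<^sub>q\<close> to the centred
  rank one matrices of the transforms, along the subsampled filtration, it bounds the main error
  term. The remaining terms are products controlled by the Cauchy--Schwarz inequality.
\<close>

section \<open>Moment spaces\<close>

text \<open>The Bochner integral of a non-integrable function is \<open>0\<close>, so a small
  \<open>Lq_norm\<close> alone says nothing. Norm estimates therefore travel together with this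
  membership predicate.\<close>

definition Lp :: "'a measure \<Rightarrow> real \<Rightarrow> ('a \<Rightarrow> 'b::euclidean_space) \<Rightarrow> bool" where
  "Lp P p X \<longleftrightarrow> X \<in> borel_measurable P \<and> integrable P (\<lambda>\<omega>. norm (X \<omega>) powr p)"

lemma Lp_measurable [measurable_dest]: "Lp P p X \<Longrightarrow> X \<in> borel_measurable P"
  by (simp add: Lp_def)

lemma Lp_integrable: "Lp P p X \<Longrightarrow> integrable P (\<lambda>\<omega>. norm (X \<omega>) powr p)"
  by (simp add: Lp_def)

lemma Lq_norm_nonneg [simp]: "0 \<le> Lq_norm P p X"
  by (simp add: Lq_norm_def)

lemma Lq_norm_powr:
  assumes "0 < p"
  shows "Lq_norm P p X powr p = (\<integral>\<omega>. norm (X \<omega>) powr p \<partial>P)"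
proof -
  have "0 \<le> (\<integral>\<omega>. norm (X \<omega>) powr p \<partial>P)" by (rule integral_nonneg_AE) auto
  then show ?thesis using assms by (simp add: Lq_norm_def powr_powr)
qed

lemma Lq_norm_leI:
  assumes "0 < p" "0 \<le> C" "(\<integral>\<omega>. norm (X \<omega>) powr p \<partial>P) \<le> C powr p"
  shows "Lq_norm P p X \<le> C"
proof (rule ccontr)
  assume "\<not> Lq_norm P p X \<le> C"
  then have "C powr p < Lq_norm P p X powr p"
    using assms by (intro powr_less_mono2) auto
  then show False using assms by (simp add: Lq_norm_powr)
qed

lemma Lq_norm_eq_0_AE:
  assumes "0 < p" "Lp P p X" "Lq_norm P p X = 0"
  shows "AE \<omega> in P. X \<omega> = 0"
proof -
  have "(\<integral>\<omega>. norm (X \<omega>) powr p \<partial>P) = 0"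
    using Lq_norm_powr[OF assms(1), of P X] assms by simp
  then have "AE \<omega> in P. norm (X \<omega>) powr p = 0"
    using integral_nonneg_eq_0_iff_AE[OF Lp_integrable[OF assms(2)]] by auto
  then show ?thesis by auto
qed

lemma Lp_mono:
  assumes "0 < p" "Lp P p Y" "X \<in> borel_measurable P" "\<And>\<omega>. norm (X \<omega>) \<le> c * norm (Y \<omega>)" "0 \<le> c"
  shows "Lp P p X" "Lq_norm P p X \<le> c * Lq_norm P p Y"
proof -
  have i: "integrable P (\<lambda>\<omega>. c powr p * norm (Y \<omega>) powr p)"
    using Lp_integrable[OF assms(2)] by simp
  have le: "norm (X \<omega>) powr p \<le> c powr p * norm (Y \<omega>) powr p" for \<omega>
    using powr_mono2[OF _ _ assms(4)[of \<omega>], of p] assms by (simp add: powr_mult)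
  have ix: "integrable P (\<lambda>\<omega>. norm (X \<omega>) powr p)"
    by (rule Bochner_Integration.integrable_bound[OF i]) (use assms le in auto)
  then show "Lp P p X" using assms by (simp add: Lp_def)
  have "(\<integral>\<omega>. norm (X \<omega>) powr p \<partial>P) \<le> (\<integral>\<omega>. c powr p * norm (Y \<omega>) powr p \<partial>P)"
    by (rule integral_mono[OF ix i le])
  also have "\<dots> = (c * Lq_norm P p Y) powr p"
    using assms by (simp add: powr_mult Lq_norm_powr)
  finally show "Lq_norm P p X \<le> c * Lq_norm P p Y"
    using assms by (intro Lq_norm_leI) auto
qed

lemma Lq_norm_cong:
  assumes "\<And>\<omega>. norm (X \<omega>) = norm (Y \<omega>)"
  shows "Lq_norm P p X = Lq_norm P p Y"
  using assms by (simp add: Lq_norm_def)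

lemma Lp_uminus: "Lp P p X \<Longrightarrow> Lp P p (\<lambda>\<omega>. - X \<omega>)"
  by (simp add: Lp_def)

lemma Lp_scaleR:
  assumes "0 < p" "Lp P p X"
  shows "Lp P p (\<lambda>\<omega>. c *\<^sub>R X \<omega>)" "Lq_norm P p (\<lambda>\<omega>. c *\<^sub>R X \<omega>) \<le> \<bar>c\<bar> * Lq_norm P p X"
  using Lp_mono[OF assms, of "\<lambda>\<omega>. c *\<^sub>R X \<omega>" "\<bar>c\<bar>"] assms Lp_measurable[OF assms(2)] by auto

text \<open>On positive arguments this is convexity of the power; if one argument is
  \<open>0\<close> it reduces to \<open>s powr p \<le> s\<close> for \<open>s\<close> in the unit
  interval.\<close>

lemma powr_convex_combination:
  fixes u v t p :: real
  assumes "0 \<le> u" "0 \<le> v" "0 \<le> t" "t \<le> 1" "1 \<le> p"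
  shows "(t * u + (1 - t) * v) powr p \<le> t * u powr p + (1 - t) * v powr p"
proof -
  have z: "(s * w) powr p \<le> s * w powr p" if "0 \<le> s" "s \<le> 1" for s w :: real
  proof (cases "s = 0")
    case False
    then have "s powr p \<le> s" using that assms by (intro powr_le_one_le) auto
    then show ?thesis by (simp add: powr_mult mult_right_mono)
  qed simp
  consider "u = 0" | "v = 0" | "0 < u" "0 < v" using assms by linarith
  then show ?thesis
  proof cases
    case 3
    then show ?thesis
      using convex_onD[OF powr_convex[OF assms(5)], of "1 - t" u v] assms by simp
  qed (use z[of t u] z[of "1 - t" v] assms in auto)
qed

text \<open>Minkowski's inequality from convexity of the power: for positive bounds \<open>A\<close>
  and \<open>B\<close> of the two norms, the sum of the pointwise norms is \<open>A + B\<close>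
  times a convex combination of the normalised ones. Bounds in place of the norms themselves avoid
  division by a vanishing norm.\<close>

lemma Lq_norm_triangle:
  assumes p: "1 \<le> p" and X: "Lp P p X" and Y: "Lp P p Y"
  shows "Lp P p (\<lambda>\<omega>. X \<omega> + Y \<omega>)"
    and "Lq_norm P p (\<lambda>\<omega>. X \<omega> + Y \<omega>) \<le> Lq_norm P p X + Lq_norm P p Y"
proof -
  note [measurable] = Lp_measurable[OF X] Lp_measurable[OF Y]
  have gen: "Lp P p (\<lambda>\<omega>. X \<omega> + Y \<omega>) \<and> Lq_norm P p (\<lambda>\<omega>. X \<omega> + Y \<omega>) \<le> A + B"
    if A: "Lq_norm P p X \<le> A" "0 < A" and B: "Lq_norm P p Y \<le> B" "0 < B" for A B
  proof -
    define t where "t = A / (A + B)"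
    have t: "0 \<le> t" "t \<le> 1" "1 - t = B / (A + B)"
      using A B by (auto simp: t_def field_simps)
    let ?f = "\<lambda>\<omega>. (A + B) powr p * (t * (norm (X \<omega>) powr p / A powr p)
                     + (1 - t) * (norm (Y \<omega>) powr p / B powr p))"
    have le: "norm (X \<omega> + Y \<omega>) powr p \<le> ?f \<omega>" for \<omega>
    proof -
      have e: "norm (X \<omega>) + norm (Y \<omega>)
          = (A + B) * (t * (norm (X \<omega>) / A) + (1 - t) * (norm (Y \<omega>) / B))"
        unfolding t(3) using A B by (simp add: t_def distrib_left)
      have "norm (X \<omega> + Y \<omega>) powr p \<le> (norm (X \<omega>) + norm (Y \<omega>)) powr p"
        using p by (intro powr_mono2 norm_triangle_ineq) auto
      also have "\<dots> = (A + B) powr p * (t * (norm (X \<omega>) / A) + (1 - t) * (norm (Y \<omega>) / B)) powr p"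
        unfolding e by (simp add: powr_mult)
      also have "\<dots> \<le> (A + B) powr p * (t * (norm (X \<omega>) / A) powr p + (1 - t) * (norm (Y \<omega>) / B) powr p)"
        using A B t p by (intro mult_left_mono powr_convex_combination) auto
      finally show ?thesis by (simp add: powr_divide)
    qed
    have i: "integrable P ?f" using X Y by (simp add: Lp_def)
    have ix: "integrable P (\<lambda>\<omega>. norm (X \<omega> + Y \<omega>) powr p)"
      by (rule Bochner_Integration.integrable_bound[OF i]) (use le in \<open>auto intro: order_trans[OF _ abs_ge_self]\<close>)
    have one: "(\<integral>\<omega>. norm (Z \<omega>) powr p \<partial>P) / C powr p \<le> 1"
      if "Lq_norm P p Z \<le> C" "0 < C" for Z :: "'a \<Rightarrow> 'b" and C
      using powr_mono2[OF _ _ that(1), of p] that p by (simp add: Lq_norm_powr)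
    have "(\<integral>\<omega>. norm (X \<omega> + Y \<omega>) powr p \<partial>P) \<le> (\<integral>\<omega>. ?f \<omega> \<partial>P)"
      by (rule integral_mono[OF ix i le])
    also have "\<dots> = (A + B) powr p * (t * ((\<integral>\<omega>. norm (X \<omega>) powr p \<partial>P) / A powr p)
                     + (1 - t) * ((\<integral>\<omega>. norm (Y \<omega>) powr p \<partial>P) / B powr p))"
      using X Y by (simp add: Lp_def)
    also have "\<dots> \<le> (A + B) powr p * (t * 1 + (1 - t) * 1)"
      using t one[OF A] one[OF B] by (intro mult_left_mono add_mono) auto
    finally have "Lq_norm P p (\<lambda>\<omega>. X \<omega> + Y \<omega>) \<le> A + B"
      using A B p by (intro Lq_norm_leI) auto
    then show ?thesis using ix by (simp add: Lp_def)
  qed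
  show "Lp P p (\<lambda>\<omega>. X \<omega> + Y \<omega>)"
    using gen[of "Lq_norm P p X + 1" "Lq_norm P p Y + 1"] by (simp add: add_nonneg_pos)
  show "Lq_norm P p (\<lambda>\<omega>. X \<omega> + Y \<omega>) \<le> Lq_norm P p X + Lq_norm P p Y"
  proof (rule field_le_epsilon)
    \<comment> \<open>Positive bounds arbitrarily close to the norms; half of \<open>e\<close> is
      spent on each.\<close>
    fix e :: real assume "0 < e"
    then show "Lq_norm P p (\<lambda>\<omega>. X \<omega> + Y \<omega>) \<le> Lq_norm P p X + Lq_norm P p Y + e"
      using gen[of "Lq_norm P p X + e/2" "Lq_norm P p Y + e/2"] by (simp add: add_nonneg_pos)
  qed
qed

lemma Lq_norm_diff:
  assumes "1 \<le> p" "Lp P p X" "Lp P p Y"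
  shows "Lp P p (\<lambda>\<omega>. X \<omega> - Y \<omega>)"
    and "Lq_norm P p (\<lambda>\<omega>. X \<omega> - Y \<omega>) \<le> Lq_norm P p X + Lq_norm P p Y"
  using Lq_norm_triangle[OF assms(1,2) Lp_uminus[OF assms(3)]]
    Lq_norm_cong[of "\<lambda>\<omega>. - Y \<omega>" Y P p] by auto

lemma Lp_zero: "0 < p \<Longrightarrow> Lp P p (\<lambda>_. 0)" "Lq_norm P p (\<lambda>_. 0) = 0"
  by (auto simp: Lp_def Lq_norm_def)

lemma Lq_norm_sum:
  assumes "1 \<le> p" "\<And>i. i \<in> I \<Longrightarrow> Lp P p (X i)"
  shows "Lp P p (\<lambda>\<omega>. \<Sum>i\<in>I. X i \<omega>) \<and> Lq_norm P p (\<lambda>\<omega>. \<Sum>i\<in>I. X i \<omega>) \<le> (\<Sum>i\<in>I. Lq_norm P p (X i))"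
  using assms(2)
proof (induction I rule: infinite_finite_induct)
  case (insert i I)
  then show ?case
    using Lq_norm_triangle[OF assms(1), of P "X i" "\<lambda>\<omega>. \<Sum>i\<in>I. X i \<omega>"] by force
next
  case empty
  show ?case using assms(1) Lp_zero(1)[of p P] by (simp add: Lp_zero(2))
next
  case (infinite I)
  then show ?case using assms(1) Lp_zero(1)[of p P] by (simp add: Lp_zero(2))
qed

section \<open>Inequalities of Hoelder and Cauchy--Schwarz type\<close>

lemma integral_normalized_powr:
  assumes "0 < p" "Lp P p X" "0 < Lq_norm P p X"
  shows "(\<integral>\<omega>. (norm (X \<omega>) / Lq_norm P p X) powr p \<partial>P) = 1"
proof -
  have "(\<integral>\<omega>. (norm (X \<omega>) / Lq_norm P p X) powr p \<partial>P) = (\<integral>\<omega>. norm (X \<omega>) powr p \<partial>P) / Lq_norm P p X powr p"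
    by (simp add: powr_divide)
  then show ?thesis using assms by (simp add: Lq_norm_powr[symmetric])
qed

text \<open>Since \<open>b * c\<close> is at most the mean of the two squares, it suffices to
  average two instances of Young's inequality with weights \<open>(p - 2) / p\<close> and
  \<open>2 / p\<close>. Zero arguments are separate; there the left side vanishes even for
  \<open>p = 2\<close>, because \<open>0 powr 0 = 0\<close>.\<close>

lemma young_three:
  fixes a b c p :: real
  assumes "2 \<le> p" "0 \<le> a" "0 \<le> b" "0 \<le> c"
  shows "a powr (p - 2) * b * c \<le> (p - 2) / p * a powr p + 1 / p * b powr p + 1 / p * c powr p"
proof -
  have y: "a powr (p - 2) * d\<^sup>2 \<le> (p - 2) / p * a powr p + 2 / p * d powr p" if d: "0 \<le> d" for d
  proof (cases "a = 0 \<or> d = 0")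
    case False
    with assms d have pos: "0 < a powr p" "0 < d powr p" by auto
    have "(p - 2) / p + 2 / p = 1" using assms by (simp add: field_simps)
    from Youngs_inequality_0[OF _ _ this pos] False assms d show ?thesis
      by (simp add: powr_powr)
  qed (use assms d in auto)
  have "b * c \<le> (b\<^sup>2 + c\<^sup>2) / 2" using sum_squares_bound[of b c] by simp
  then have "a powr (p - 2) * (b * c) \<le> a powr (p - 2) * ((b\<^sup>2 + c\<^sup>2) / 2)"
    by (rule mult_left_mono) simp
  also have "\<dots> = (a powr (p - 2) * b\<^sup>2 + a powr (p - 2) * c\<^sup>2) / 2"
    by (simp add: field_simps)
  also have "\<dots> \<le> ((p - 2) / p * a powr p + 2 / p * b powr p + ((p - 2) / p * a powr p + 2 / p * c powr p)) / 2"
    by (intro divide_right_mono add_mono y assms) simp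
  also have "\<dots> = (p - 2) / p * a powr p + 1 / p * b powr p + 1 / p * c powr p"
    by (simp add: add_divide_distrib)
  finally show ?thesis by (simp add: mult.assoc)
qed

text \<open>Hoelder with exponents \<open>p / (p - 2)\<close>, \<open>p\<close>, \<open>p\<close>:
  divide each function by its norm, integrate \<open>young_three\<close>, and use that its three
  coefficients sum to \<open>1\<close>.\<close>

lemma Hoelder_three:
  assumes p: "2 \<le> p" and X: "Lp P p X" and Y: "Lp P p Y" and Z: "Lp P p Z"
  shows "integrable P (\<lambda>\<omega>. norm (X \<omega>) powr (p - 2) * norm (Y \<omega>) * norm (Z \<omega>))"
    and "(\<integral>\<omega>. norm (X \<omega>) powr (p - 2) * norm (Y \<omega>) * norm (Z \<omega>) \<partial>P)
      \<le> Lq_norm P p X powr (p - 2) * Lq_norm P p Y * Lq_norm P p Z"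
proof -
  note [measurable] = Lp_measurable[OF X] Lp_measurable[OF Y] Lp_measurable[OF Z]
  let ?f = "\<lambda>\<omega>. norm (X \<omega>) powr (p - 2) * norm (Y \<omega>) * norm (Z \<omega>)"
  let ?b = "\<lambda>\<omega>. (p - 2) / p * norm (X \<omega>) powr p + 1 / p * norm (Y \<omega>) powr p + 1 / p * norm (Z \<omega>) powr p"
  have "integrable P ?b" using X Y Z by (simp add: Lp_def)
  then show i: "integrable P ?f"
  proof (rule Bochner_Integration.integrable_bound)
    have "norm (?f \<omega>) \<le> norm (?b \<omega>)" for \<omega>
    proof -
      have "norm (?f \<omega>) = ?f \<omega>" by simp
      also have "\<dots> \<le> ?b \<omega>" using p by (intro young_three) auto
      finally show ?thesis by (simp only: real_norm_def order_trans[OF _ abs_ge_self])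
    qed
    then show "AE \<omega> in P. norm (?f \<omega>) \<le> norm (?b \<omega>)" by (rule AE_I2)
  qed simp
  let ?A = "Lq_norm P p X" and ?B = "Lq_norm P p Y" and ?C = "Lq_norm P p Z"
  show "(\<integral>\<omega>. ?f \<omega> \<partial>P) \<le> ?A powr (p - 2) * ?B * ?C"
  proof (cases "?A = 0 \<or> ?B = 0 \<or> ?C = 0")
    case True
    then have "AE \<omega> in P. ?f \<omega> = 0"
      using Lq_norm_eq_0_AE[OF _ X] Lq_norm_eq_0_AE[OF _ Y] Lq_norm_eq_0_AE[OF _ Z] p by fastforce
    then have "(\<integral>\<omega>. ?f \<omega> \<partial>P) = (\<integral>\<omega>. 0 \<partial>P)"
      by (intro integral_cong_AE) auto
    then show ?thesis by simp
  next
    case False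
    then have pos: "0 < ?A" "0 < ?B" "0 < ?C" using Lq_norm_nonneg by (metis less_le)+
    let ?g = "\<lambda>\<omega>. (p - 2) / p * (norm (X \<omega>) / ?A) powr p + 1 / p * (norm (Y \<omega>) / ?B) powr p
      + 1 / p * (norm (Z \<omega>) / ?C) powr p"
    have ig: "integrable P ?g" using X Y Z by (simp add: Lp_def powr_divide)
    have "?f \<omega> \<le> ?A powr (p - 2) * ?B * ?C * ?g \<omega>" for \<omega>
    proof -
      have "?f \<omega> = ?A powr (p - 2) * ?B * ?C *
          ((norm (X \<omega>) / ?A) powr (p - 2) * (norm (Y \<omega>) / ?B) * (norm (Z \<omega>) / ?C))"
        using pos by (simp add: powr_divide)
      also have "\<dots> \<le> ?A powr (p - 2) * ?B * ?C * ?g \<omega>"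
        using p by (intro mult_left_mono young_three) auto
      finally show ?thesis .
    qed
    then have "(\<integral>\<omega>. ?f \<omega> \<partial>P) \<le> (\<integral>\<omega>. ?A powr (p - 2) * ?B * ?C * ?g \<omega> \<partial>P)"
      using i ig by (intro integral_mono) auto
    also have "\<dots> = ?A powr (p - 2) * ?B * ?C * (\<integral>\<omega>. ?g \<omega> \<partial>P)"
      by simp
    also have "(\<integral>\<omega>. ?g \<omega> \<partial>P) = (p - 2) / p * 1 + 1 / p * 1 + 1 / p * 1"
    proof -
      have "integrable P (\<lambda>\<omega>. (norm (X \<omega>) / ?A) powr p)" "integrable P (\<lambda>\<omega>. (norm (Y \<omega>) / ?B) powr p)"
        "integrable P (\<lambda>\<omega>. (norm (Z \<omega>) / ?C) powr p)"
        using X Y Z by (simp_all add: Lp_def powr_divide)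
      then show ?thesis
        using integral_normalized_powr[OF _ X pos(1)] integral_normalized_powr[OF _ Y pos(2)]
          integral_normalized_powr[OF _ Z pos(3)] p
        by simp
    qed
    also have "\<dots> = 1" using p by (simp add: field_simps)
    finally show ?thesis by simp
  qed
qed

text \<open>Cauchy--Schwarz for norms, via the arithmetic-geometric mean inequality for the
  \<open>r\<close>-th powers with a free ratio \<open>c / d\<close>. Ratio \<open>1\<close> already
  gives integrability; the sharp constant needs the balanced one.\<close>

lemma Lq_norm_mult:
  assumes r: "1 \<le> r" and U: "Lp P (2 * r) U" and V: "Lp P (2 * r) V"
    and Z: "Z \<in> borel_measurable P" "\<And>\<omega>. norm (Z \<omega>) \<le> norm (U \<omega>) * norm (V \<omega>)"
  shows "Lp P r Z" and "Lq_norm P r Z \<le> Lq_norm P (2 * r) U * Lq_norm P (2 * r) V"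
proof -
  note [measurable] = Lp_measurable[OF U] Lp_measurable[OF V] Z(1)
  let ?a = "\<lambda>\<omega>. norm (U \<omega>) powr r" and ?b = "\<lambda>\<omega>. norm (V \<omega>) powr r"
  have sq: "(x powr r)\<^sup>2 = x powr (2 * r)" if "0 \<le> x" for x :: real
    unfolding power2_eq_square powr_add[symmetric] by simp
  have i: "integrable P (\<lambda>\<omega>. norm (U \<omega>) powr (2 * r))" "integrable P (\<lambda>\<omega>. norm (V \<omega>) powr (2 * r))"
    using U V by (auto simp: Lp_def)
  have amgm: "a * b \<le> (a\<^sup>2 * (c/d) + b\<^sup>2 * (d/c)) / 2" if "0 < c" "0 < d" for a b c d :: real
  proof -
    have "0 \<le> (a * c - b * d)\<^sup>2 / (2 * c * d)" using that by simp
    also have "\<dots> = (a\<^sup>2 * (c/d) + b\<^sup>2 * (d/c)) / 2 - a * b"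
      using that by (simp add: power2_eq_square field_simps)
    finally show ?thesis by simp
  qed
  have zp: "norm (Z \<omega>) powr r \<le> ?a \<omega> * ?b \<omega>" for \<omega>
    using powr_mono2[OF _ _ Z(2)[of \<omega>], of r] r by (simp add: powr_mult)
  have zle: "norm (Z \<omega>) powr r
      \<le> (norm (U \<omega>) powr (2 * r) * (c/d) + norm (V \<omega>) powr (2 * r) * (d/c)) / 2"
    if "0 < c" "0 < d" for \<omega> c d
    using order_trans[OF zp amgm[OF that]] by (simp add: sq)
  have iz: "integrable P (\<lambda>\<omega>. norm (Z \<omega>) powr r)"
  proof (rule Bochner_Integration.integrable_bound)
    show "integrable P (\<lambda>\<omega>. (norm (U \<omega>) powr (2 * r) * (1/1) + norm (V \<omega>) powr (2 * r) * (1/1)) / 2)"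
      using i by simp
    show "AE \<omega> in P. norm (norm (Z \<omega>) powr r)
        \<le> norm ((norm (U \<omega>) powr (2 * r) * (1/1) + norm (V \<omega>) powr (2 * r) * (1/1)) / 2)"
    proof (rule AE_I2)
      fix \<omega>
      show "norm (norm (Z \<omega>) powr r)
        \<le> norm ((norm (U \<omega>) powr (2 * r) * (1/1) + norm (V \<omega>) powr (2 * r) * (1/1)) / 2)"
        using zle[OF zero_less_one zero_less_one, of \<omega>]
        by (simp only: real_norm_def abs_of_nonneg[OF powr_ge_zero] order_trans[OF _ abs_ge_self])
    qed
  qed simp
  then show "Lp P r Z" by (simp add: Lp_def)
  let ?A = "Lq_norm P (2 * r) U" and ?B = "Lq_norm P (2 * r) V"
  show "Lq_norm P r Z \<le> ?A * ?B"
  proof (cases "?A = 0 \<or> ?B = 0")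
    case True
    then have "(AE \<omega> in P. U \<omega> = 0) \<or> (AE \<omega> in P. V \<omega> = 0)"
      using Lq_norm_eq_0_AE[OF _ U] Lq_norm_eq_0_AE[OF _ V] r by auto
    then have "AE \<omega> in P. norm (U \<omega>) * norm (V \<omega>) = 0" by (auto elim: eventually_mono)
    then have "AE \<omega> in P. norm (Z \<omega>) powr r = 0"
    proof (rule eventually_mono)
      fix \<omega> assume "norm (U \<omega>) * norm (V \<omega>) = 0"
      then show "norm (Z \<omega>) powr r = 0" using Z(2)[of \<omega>] by auto
    qed
    then have "(\<integral>\<omega>. norm (Z \<omega>) powr r \<partial>P) = (\<integral>\<omega>. 0 \<partial>P)"
      by (intro integral_cong_AE) auto
    then show ?thesis using r by (intro Lq_norm_leI) auto
  next
    case False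
    then have pos: "0 < ?A" "0 < ?B" using Lq_norm_nonneg by (metis less_le)+
    \<comment> \<open>With this choice the two summands of the bound have equal integrals, both
      \<open>c * d\<close>.\<close>
    define c d where "c = ?B powr r" and "d = ?A powr r"
    have cd: "0 < c" "0 < d" using pos by (auto simp: c_def d_def)
    have "(\<integral>\<omega>. norm (Z \<omega>) powr r \<partial>P) \<le>
        (\<integral>\<omega>. (norm (U \<omega>) powr (2 * r) * (c/d) + norm (V \<omega>) powr (2 * r) * (d/c)) / 2 \<partial>P)"
      using iz i zle[OF cd] by (intro integral_mono) auto
    also have "\<dots> = (?A powr (2 * r) * (c/d) + ?B powr (2 * r) * (d/c)) / 2"
      using i r by (simp add: Lq_norm_powr)
    also have "\<dots> = (d\<^sup>2 * (c/d) + c\<^sup>2 * (d/c)) / 2"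
      using pos by (simp add: c_def d_def sq)
    also have "\<dots> = c * d" using cd by (simp add: power2_eq_square)
    also have "\<dots> = (?A * ?B) powr r" by (simp add: c_def d_def powr_mult)
    finally show ?thesis using r pos by (intro Lq_norm_leI) auto
  qed
qed

section \<open>Comparison of moments on a probability space\<close>

lemma (in prob_space) Lp_const:
  assumes "0 < p"
  shows "Lp M p (\<lambda>_. c)" "Lq_norm M p (\<lambda>_. c) = norm c"
  using assms by (simp_all add: Lp_def Lq_norm_def prob_space powr_powr)

text \<open>Cauchy--Schwarz against the constant \<open>1\<close>. The duality method needs
  exponents at least \<open>2\<close> while \<open>q\<close> may lie below, so the main estimate is
  made at exponent \<open>2 * q\<close> and brought down by this lemma.\<close>

lemma (in prob_space) Lq_norm_double:
  assumes "1 \<le> r" "Lp M (2 * r) X"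
  shows "Lp M r X" "Lq_norm M r X \<le> Lq_norm M (2 * r) X"
  using Lq_norm_mult[OF assms Lp_const(1), of X "1::real"] Lp_measurable[OF assms(2)]
    Lp_const(2)[of "2 * r" "1::real"] assms(1) by auto

lemma (in prob_space) Lp_imp_integrable:
  fixes X :: "'a \<Rightarrow> 'b::euclidean_space"
  assumes "2 \<le> p" "Lp M p X"
  shows "integrable M X" "norm (\<integral>\<omega>. X \<omega> \<partial>M) \<le> Lq_norm M p X"
proof -
  note h = Hoelder_three[OF assms(1) Lp_const(1)[of p "1::real"] assms(2) Lp_const(1)[of p "1::real"]]
  have i: "integrable M (\<lambda>\<omega>. norm (X \<omega>))" using h(1) assms by simp
  then show "integrable M X" using assms by (simp add: integrable_norm_iff Lp_def)
  have "norm (\<integral>\<omega>. X \<omega> \<partial>M) \<le> (\<integral>\<omega>. norm (X \<omega>) \<partial>M)" by (rule integral_norm_bound)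
  also have "\<dots> \<le> Lq_norm M p X" using h(2) assms by (simp add: Lp_const(2))
  finally show "norm (\<integral>\<omega>. X \<omega> \<partial>M) \<le> Lq_norm M p X" .
qed

section \<open>The duality map of the moment spaces\<close>

text \<open>From \<open>ln t \<le> t - 1\<close> at \<open>t = a / b\<close> and
  \<open>1 + u \<le> exp u\<close>. The extra factor \<open>b\<close> is what allows
  \<open>0 < r < 1\<close>, where the power itself is not Lipschitz near \<open>0\<close>.\<close>

lemma powr_diff_mult_le:
  fixes a b r :: real
  assumes "0 \<le> b" "b \<le> a" "0 \<le> r"
  shows "(a powr r - b powr r) * b \<le> r * a powr r * (a - b)"
proof (cases "b = 0")
  case False
  then have pos: "0 < a" "0 < b" using assms by auto
  have "1 - r * (a / b - 1) \<le> 1 + r * ln (b / a)"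
  proof -
    have "ln (a / b) \<le> a / b - 1" using pos by (intro ln_le_minus_one) auto
    then have "r * ln (a / b) \<le> r * (a / b - 1)" using assms by (intro mult_left_mono)
    then show ?thesis using pos by (simp add: ln_div algebra_simps)
  qed
  also have "\<dots> \<le> (b / a) powr r" using pos by (simp add: powr_def)
  finally have "a powr r * b * (1 - r * (a / b - 1)) \<le> a powr r * b * (b / a) powr r"
    using pos by (intro mult_left_mono) auto
  moreover have "a powr r * b * (1 - r * (a / b - 1)) = a powr r * b - r * a powr r * (a - b)"
    using pos by (simp add: field_simps)
  moreover have "a powr r * b * (b / a) powr r = b powr r * b"
    using pos by (simp add: powr_divide)
  ultimately show ?thesis by (simp add: left_diff_distrib)
qed (use assms in simp)

text \<open>Let \<open>x\<close> have the larger norm, split off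
  \<open>norm x powr r *\<^sub>R (x - y)\<close> and bound the remaining multiple of
  \<open>y\<close> by \<open>powr_diff_mult_le\<close>. The sum of both powers makes the right side
  symmetric in \<open>x\<close> and \<open>y\<close>.\<close>

lemma norm_powr_scaleR_diff_le:
  fixes x y :: "'b::real_normed_vector"
  assumes "0 \<le> r"
  shows "norm (norm x powr r *\<^sub>R x - norm y powr r *\<^sub>R y)
    \<le> (r + 1) * (norm x powr r + norm y powr r) * norm (x - y)"
proof -
  have main: "norm (norm x powr r *\<^sub>R x - norm y powr r *\<^sub>R y) \<le> (r + 1) * norm x powr r * norm (x - y)"
    if le: "norm y \<le> norm x" for x y :: 'b
  proof -
    have "norm x powr r *\<^sub>R x - norm y powr r *\<^sub>R y
        = norm x powr r *\<^sub>R (x - y) + (norm x powr r - norm y powr r) *\<^sub>R y"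
      by (simp add: algebra_simps)
    then have "norm (norm x powr r *\<^sub>R x - norm y powr r *\<^sub>R y)
        \<le> norm x powr r * norm (x - y) + (norm x powr r - norm y powr r) * norm y"
      using norm_triangle_ineq[of "norm x powr r *\<^sub>R (x - y)" "(norm x powr r - norm y powr r) *\<^sub>R y"]
        powr_mono2[OF assms norm_ge_zero le] by simp
    also have "\<dots> \<le> norm x powr r * norm (x - y) + r * norm x powr r * (norm x - norm y)"
      using powr_diff_mult_le[OF norm_ge_zero le assms] by simp
    also have "\<dots> \<le> norm x powr r * norm (x - y) + r * norm x powr r * norm (x - y)"
      using assms norm_triangle_ineq2[of x y] by (intro add_left_mono mult_left_mono) auto
    finally show ?thesis by (simp add: algebra_simps)
  qed
  have ext: "(r + 1) * u * d \<le> (r + 1) * (u + v) * d" if "0 \<le> v" "0 \<le> d" for u v d :: real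
    using assms that by (intro mult_right_mono mult_left_mono) auto
  show ?thesis
  proof (cases "norm y \<le> norm x")
    case True
    then show ?thesis using main[OF True] ext[of "norm y powr r" "norm (x - y)" "norm x powr r"] by simp
  next
    case False
    then show ?thesis using main[of x y] ext[of "norm x powr r" "norm (x - y)" "norm y powr r"]
      by (simp add: norm_minus_commute add.commute)
  qed
qed

text \<open>The functional \<open>h \<mapsto> dual_map P p X h\<close> is the derivative of \<open>Lq_norm P p\<close> squared at \<open>X\<close>;
  at a null vector it is \<open>0\<close>, because \<open>0 powr (2 - p) = 0\<close>.\<close>

definition dual_map :: "'a measure \<Rightarrow> real \<Rightarrow> ('a \<Rightarrow> 'b::euclidean_space) \<Rightarrow> ('a \<Rightarrow> 'b) \<Rightarrow> real" where
  "dual_map P p X H = 2 * Lq_norm P p X powr (2 - p) * (\<integral>\<omega>. (norm (X \<omega>) powr (p - 2) *\<^sub>R X \<omega>) \<bullet> H \<omega> \<partial>P)"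

lemma dual_integrand:
  assumes p: "2 \<le> p" and X: "Lp P p X" and H: "Lp P p H"
  shows "integrable P (\<lambda>\<omega>. (norm (X \<omega>) powr (p - 2) *\<^sub>R X \<omega>) \<bullet> H \<omega>)"
    and "\<bar>\<integral>\<omega>. (norm (X \<omega>) powr (p - 2) *\<^sub>R X \<omega>) \<bullet> H \<omega> \<partial>P\<bar>
      \<le> Lq_norm P p X powr (p - 2) * Lq_norm P p X * Lq_norm P p H"
proof -
  note [measurable] = Lp_measurable[OF X] Lp_measurable[OF H]
  note h = Hoelder_three[OF p X X H]
  have le: "\<bar>(norm (X \<omega>) powr (p - 2) *\<^sub>R X \<omega>) \<bullet> H \<omega>\<bar> \<le> norm (X \<omega>) powr (p - 2) * norm (X \<omega>) * norm (H \<omega>)" for \<omega>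
    using Cauchy_Schwarz_ineq2[of "norm (X \<omega>) powr (p - 2) *\<^sub>R X \<omega>" "H \<omega>"] by simp
  show i: "integrable P (\<lambda>\<omega>. (norm (X \<omega>) powr (p - 2) *\<^sub>R X \<omega>) \<bullet> H \<omega>)"
    by (rule Bochner_Integration.integrable_bound[OF h(1)]) (use le in auto)
  have "\<bar>\<integral>\<omega>. (norm (X \<omega>) powr (p - 2) *\<^sub>R X \<omega>) \<bullet> H \<omega> \<partial>P\<bar>
      \<le> (\<integral>\<omega>. \<bar>(norm (X \<omega>) powr (p - 2) *\<^sub>R X \<omega>) \<bullet> H \<omega>\<bar> \<partial>P)"
    by (rule integral_abs_bound)
  also have "\<dots> \<le> (\<integral>\<omega>. norm (X \<omega>) powr (p - 2) * norm (X \<omega>) * norm (H \<omega>) \<partial>P)"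
    using i h(1) le by (intro integral_mono) auto
  finally show "\<bar>\<integral>\<omega>. (norm (X \<omega>) powr (p - 2) *\<^sub>R X \<omega>) \<bullet> H \<omega> \<partial>P\<bar>
      \<le> Lq_norm P p X powr (p - 2) * Lq_norm P p X * Lq_norm P p H" using h(2) by linarith
qed

lemma dual_map_diff:
  assumes "2 \<le> p" "Lp P p X" "Lp P p H" "Lp P p K"
  shows "dual_map P p X (\<lambda>\<omega>. H \<omega> - K \<omega>) = dual_map P p X H - dual_map P p X K"
  using dual_integrand(1)[OF assms(1,2,3)] dual_integrand(1)[OF assms(1,2,4)]
  by (simp add: dual_map_def inner_diff_right right_diff_distrib del: inner_scaleR_left)

lemma powr_cancel: "0 < x \<Longrightarrow> x powr (2 - p) * x powr (p - 2) = (1::real)"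
  by (simp add: powr_add[symmetric])

lemma dual_map_bound:
  assumes "2 \<le> p" "Lp P p X" "Lp P p H"
  shows "\<bar>dual_map P p X H\<bar> \<le> 2 * Lq_norm P p X * Lq_norm P p H"
proof (cases "Lq_norm P p X = 0")
  case False
  let ?X = "Lq_norm P p X"
  have pos: "0 < ?X" using False Lq_norm_nonneg[of P p X] by linarith
  have "\<bar>dual_map P p X H\<bar> \<le> 2 * ?X powr (2 - p) * (?X powr (p - 2) * ?X * Lq_norm P p H)"
    unfolding dual_map_def abs_mult using dual_integrand(2)[OF assms] by (intro mult_mono) auto
  also have "\<dots> = 2 * (?X powr (2 - p) * ?X powr (p - 2)) * ?X * Lq_norm P p H" by simp
  finally show ?thesis unfolding powr_cancel[OF pos] by simp
qed (simp add: dual_map_def)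

lemma dual_map_self:
  assumes "2 \<le> p" "Lp P p X"
  shows "dual_map P p X X = 2 * (Lq_norm P p X)\<^sup>2"
proof (cases "Lq_norm P p X = 0")
  case False
  then have pos: "0 < Lq_norm P p X" using Lq_norm_nonneg[of P p X] by linarith
  have "(norm (X \<omega>) powr (p - 2) *\<^sub>R X \<omega>) \<bullet> X \<omega> = norm (X \<omega>) powr p" for \<omega>
  proof (cases "X \<omega> = 0")
    case False
    then have "norm (X \<omega>) powr (p - 2) * norm (X \<omega>) powr 2 = norm (X \<omega>) powr p"
      unfolding powr_add[symmetric] by simp
    then show ?thesis by (simp add: dot_square_norm)
  qed simp
  then have "dual_map P p X X = 2 * Lq_norm P p X powr (2 - p) * Lq_norm P p X powr p"
    using assms by (simp add: dual_map_def Lq_norm_powr)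
  also have "\<dots> = 2 * Lq_norm P p X powr 2" unfolding mult.assoc powr_add[symmetric] by simp
  finally show ?thesis using pos by simp
qed (simp add: dual_map_def)

text \<open>Convexity without differentiation: the functional at \<open>X\<close> takes twice the
  squared norm as its value on \<open>X\<close>, at most twice the product of the norms on
  \<open>Z\<close>, and \<open>2 * a * b \<le> a\<^sup>2 + b\<^sup>2\<close>.\<close>

lemma Lq_norm_square_diff_le_dual_map:
  assumes p: "2 \<le> p" and X: "Lp P p X" and Z: "Lp P p Z"
  shows "(Lq_norm P p X)\<^sup>2 - (Lq_norm P p Z)\<^sup>2 \<le> dual_map P p X (\<lambda>\<omega>. X \<omega> - Z \<omega>)"
proof -
  have "dual_map P p X Z \<le> 2 * Lq_norm P p X * Lq_norm P p Z"
    using dual_map_bound[OF p X Z] by simp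
  then show ?thesis
    using sum_squares_bound[of "Lq_norm P p X" "Lq_norm P p Z"]
    by (simp add: dual_map_diff[OF p X X Z] dual_map_self[OF p X])
qed

text \<open>By symmetry let \<open>X\<close> have the larger norm \<open>x\<close>. Changing the
  integrand while keeping the prefactor of \<open>X\<close> costs \<open>4 * (p - 1)\<close>,
  changing the prefactor costs \<open>2 * (p - 2)\<close>; together this is at most
  \<open>6 * (p - 1)\<close>.\<close>

lemma dual_map_lipschitz:
  assumes p: "2 \<le> p" and X: "Lp P p X" and Y: "Lp P p Y" and H: "Lp P p H"
  shows "\<bar>dual_map P p X H - dual_map P p Y H\<bar>
    \<le> 6 * (p - 1) * Lq_norm P p (\<lambda>\<omega>. X \<omega> - Y \<omega>) * Lq_norm P p H"
proof -
  have main: "\<bar>dual_map P p X H - dual_map P p Y H\<bar>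
      \<le> 6 * (p - 1) * Lq_norm P p (\<lambda>\<omega>. X \<omega> - Y \<omega>) * Lq_norm P p H"
    if X: "Lp P p X" and Y: "Lp P p Y" and le: "Lq_norm P p Y \<le> Lq_norm P p X" for X Y
  proof -
    note [measurable] = Lp_measurable[OF X] Lp_measurable[OF Y] Lp_measurable[OF H]
    define x y d h where "x = Lq_norm P p X" and "y = Lq_norm P p Y"
      and "d = Lq_norm P p (\<lambda>\<omega>. X \<omega> - Y \<omega>)" and "h = Lq_norm P p H"
    have nn: "0 \<le> x" "0 \<le> y" "0 \<le> d" "0 \<le> h" by (auto simp: x_def y_def d_def h_def)
    have p1: "1 \<le> p" using p by simp
    have XY: "Lp P p (\<lambda>\<omega>. X \<omega> - Y \<omega>)" by (rule Lq_norm_diff(1)[OF p1 X Y])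
    have xyd: "x - y \<le> d"
      using Lq_norm_triangle(2)[OF p1 Y XY] by (simp add: x_def y_def d_def)
    define I where "I = (\<lambda>X. \<integral>\<omega>. (norm (X \<omega>) powr (p - 2) *\<^sub>R X \<omega>) \<bullet> H \<omega> \<partial>P)"
    have dm: "dual_map P p X H = 2 * x powr (2 - p) * I X" "dual_map P p Y H = 2 * y powr (2 - p) * I Y"
      by (simp_all add: dual_map_def I_def x_def y_def)
    show ?thesis
    proof (cases "x = 0")
      case True
      then have "y = 0" using le nn by (simp only: flip: x_def y_def)
      then show ?thesis using True nn p by (simp add: dm flip: d_def h_def)
    next
      case False
      then have x: "0 < x" using nn by simp
      note h1 = Hoelder_three[OF p X XY H] and h2 = Hoelder_three[OF p Y XY H]
      let ?b = "\<lambda>\<omega>. (p - 1) * (norm (X \<omega>) powr (p - 2) * norm (X \<omega> - Y \<omega>) * norm (H \<omega>)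
        + norm (Y \<omega>) powr (p - 2) * norm (X \<omega> - Y \<omega>) * norm (H \<omega>))"
      have "\<bar>(norm (X \<omega>) powr (p - 2) *\<^sub>R X \<omega>) \<bullet> H \<omega> - (norm (Y \<omega>) powr (p - 2) *\<^sub>R Y \<omega>) \<bullet> H \<omega>\<bar> \<le> ?b \<omega>" for \<omega>
      proof -
        have "\<bar>(norm (X \<omega>) powr (p - 2) *\<^sub>R X \<omega> - norm (Y \<omega>) powr (p - 2) *\<^sub>R Y \<omega>) \<bullet> H \<omega>\<bar>
          \<le> norm (norm (X \<omega>) powr (p - 2) *\<^sub>R X \<omega> - norm (Y \<omega>) powr (p - 2) *\<^sub>R Y \<omega>) * norm (H \<omega>)"
          by (rule Cauchy_Schwarz_ineq2)
        also have "\<dots> \<le> (p - 2 + 1) * (norm (X \<omega>) powr (p - 2) + norm (Y \<omega>) powr (p - 2)) * norm (X \<omega> - Y \<omega>) * norm (H \<omega>)"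
          using p by (intro mult_right_mono norm_powr_scaleR_diff_le) auto
        finally show ?thesis by (simp add: inner_diff_left algebra_simps)
      qed
      note pointwise = this
      note ix = dual_integrand(1)[OF p X H] and iy = dual_integrand(1)[OF p Y H]
      have "I X - I Y = (\<integral>\<omega>. (norm (X \<omega>) powr (p - 2) *\<^sub>R X \<omega>) \<bullet> H \<omega> - (norm (Y \<omega>) powr (p - 2) *\<^sub>R Y \<omega>) \<bullet> H \<omega> \<partial>P)"
        unfolding I_def by (rule Bochner_Integration.integral_diff[OF ix iy, symmetric])
      also have "\<bar>\<dots>\<bar> \<le> (\<integral>\<omega>. \<bar>(norm (X \<omega>) powr (p - 2) *\<^sub>R X \<omega>) \<bullet> H \<omega> - (norm (Y \<omega>) powr (p - 2) *\<^sub>R Y \<omega>) \<bullet> H \<omega>\<bar> \<partial>P)"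
        by (rule integral_abs_bound)
      also have "\<dots> \<le> (\<integral>\<omega>. ?b \<omega> \<partial>P)"
        using h1(1) h2(1) by (intro integral_mono integrable_abs Bochner_Integration.integrable_diff[OF ix iy] pointwise) simp
      finally have "\<bar>I X - I Y\<bar> \<le> (\<integral>\<omega>. ?b \<omega> \<partial>P)" .
      also have "\<dots> \<le> (p - 1) * (x powr (p - 2) * d * h + y powr (p - 2) * d * h)"
        using h1 h2 p by (auto simp: x_def y_def d_def h_def intro!: mult_left_mono add_mono)
      also have "\<dots> \<le> (p - 1) * (x powr (p - 2) * d * h + x powr (p - 2) * d * h)"
        using le nn p by (intro mult_left_mono add_mono mult_right_mono powr_mono2) (auto simp: x_def y_def)
      finally have D: "\<bar>I X - I Y\<bar> \<le> 2 * (p - 1) * x powr (p - 2) * d * h" by (simp add: algebra_simps)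
      have one: "2 * x powr (2 - p) * \<bar>I X - I Y\<bar> \<le> 4 * (p - 1) * d * h"
      proof -
        have "2 * x powr (2 - p) * \<bar>I X - I Y\<bar> \<le> 2 * x powr (2 - p) * (2 * (p - 1) * x powr (p - 2) * d * h)"
          using D by (intro mult_left_mono) auto
        also have "\<dots> = 4 * (p - 1) * d * h * (x powr (2 - p) * x powr (p - 2))" by simp
        finally show ?thesis unfolding powr_cancel[OF x] by simp
      qed
      \<comment> \<open>For \<open>p > 2\<close> the prefactor \<open>y powr (2 - p)\<close> is
        unbounded as \<open>y\<close> tends to \<open>0\<close>; the factor
        \<open>y powr (p - 2) * y\<close> in the bound on \<open>I Y\<close> absorbs it.\<close>
      have two: "2 * \<bar>x powr (2 - p) - y powr (2 - p)\<bar> * \<bar>I Y\<bar> \<le> 2 * (p - 2) * d * h"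
      proof (cases "y = 0")
        case True
        then have "I Y = 0" using dual_integrand(2)[OF p Y H] by (simp add: I_def y_def)
        then show ?thesis using p nn by simp
      next
        case False
        then have y: "0 < y" using nn by simp
        have iy: "\<bar>I Y\<bar> \<le> y powr (p - 2) * y * h"
          using dual_integrand(2)[OF p Y H] by (simp add: I_def y_def h_def)
        have ge: "x powr (2 - p) \<le> y powr (2 - p)"
          using p y le by (intro powr_mono2') (auto simp: x_def y_def)
        have "2 * \<bar>x powr (2 - p) - y powr (2 - p)\<bar> * \<bar>I Y\<bar>
            \<le> 2 * (y powr (2 - p) - x powr (2 - p)) * (y powr (p - 2) * y * h)"
          using ge iy by (intro mult_mono) auto
        also have "\<dots> = 2 * h * y * (y powr (2 - p) * y powr (p - 2) - x powr (2 - p) * y powr (p - 2))"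
          by (simp add: algebra_simps)
        \<comment> \<open>Both products are \<open>1\<close>; trading one for the other exposes
          \<open>x powr (2 - p)\<close> and a difference of powers times \<open>y\<close>, the form
          of \<open>powr_diff_mult_le\<close>.\<close>
        also have "y powr (2 - p) * y powr (p - 2) = x powr (2 - p) * x powr (p - 2)"
          by (simp only: powr_cancel[OF y] powr_cancel[OF x])
        also have "2 * h * y * (x powr (2 - p) * x powr (p - 2) - x powr (2 - p) * y powr (p - 2))
            = 2 * h * x powr (2 - p) * ((x powr (p - 2) - y powr (p - 2)) * y)"
          by (simp add: algebra_simps)
        also have "\<dots> \<le> 2 * h * x powr (2 - p) * ((p - 2) * x powr (p - 2) * (x - y))"
          using le nn p by (intro mult_left_mono powr_diff_mult_le) (auto simp: x_def y_def)
        also have "\<dots> = 2 * (p - 2) * (x - y) * h * (x powr (2 - p) * x powr (p - 2))" by simp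
        also have "\<dots> \<le> 2 * (p - 2) * d * h"
          unfolding powr_cancel[OF x] using xyd p nn by (auto intro!: mult_right_mono mult_left_mono)
        finally show ?thesis .
      qed
      have "dual_map P p X H - dual_map P p Y H
          = 2 * x powr (2 - p) * (I X - I Y) + 2 * (x powr (2 - p) - y powr (2 - p)) * I Y"
        unfolding dm by (simp add: algebra_simps)
      then have "\<bar>dual_map P p X H - dual_map P p Y H\<bar>
          \<le> 2 * x powr (2 - p) * \<bar>I X - I Y\<bar> + 2 * \<bar>x powr (2 - p) - y powr (2 - p)\<bar> * \<bar>I Y\<bar>"
        using abs_triangle_ineq[of "2 * x powr (2 - p) * (I X - I Y)" "2 * (x powr (2 - p) - y powr (2 - p)) * I Y"]
        by (simp only: abs_mult abs_numeral abs_of_nonneg[OF powr_ge_zero])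
      also have "\<dots> \<le> 4 * (p - 1) * d * h + 2 * (p - 2) * d * h" using one two by linarith
      also have "\<dots> \<le> 6 * (p - 1) * d * h"
        using nn by (simp add: algebra_simps)
      finally show ?thesis by (simp add: d_def h_def)
    qed
  qed
  show ?thesis
  proof (cases "Lq_norm P p Y \<le> Lq_norm P p X")
    case True then show ?thesis using main[OF X Y] by simp
  next
    case False
    have "Lq_norm P p (\<lambda>\<omega>. Y \<omega> - X \<omega>) = Lq_norm P p (\<lambda>\<omega>. X \<omega> - Y \<omega>)"
      by (rule Lq_norm_cong) (rule norm_minus_commute)
    then show ?thesis using main[OF Y X] False by (simp add: abs_minus_commute)
  qed
qed

section \<open>A moment inequality for weighted sums of mixing sequences\<close>

lemma (in prob_space) indep_set_imp_indep_var:
  assumes ind: "indep_set (sets A) (sets B)" and A: "subalgebra M A" and B: "subalgebra M B"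
    and X: "X \<in> measurable A S" and Y: "Y \<in> measurable B T"
  shows "indep_var S X T Y"
proof -
  have sA: "sigma_sets (space M) {X -` C \<inter> space M |C. C \<in> sets S} \<subseteq> sets A"
  proof -
    have "sigma_sets (space A) {X -` C \<inter> space A |C. C \<in> sets S} \<subseteq> sets A"
      using measurable_sets[OF X] by (intro sets.sigma_sets_subset) auto
    then show ?thesis using A by (simp add: subalgebra_def)
  qed
  have sB: "sigma_sets (space M) {Y -` C \<inter> space M |C. C \<in> sets T} \<subseteq> sets B"
  proof -
    have "sigma_sets (space B) {Y -` C \<inter> space B |C. C \<in> sets T} \<subseteq> sets B"
      using measurable_sets[OF Y] by (intro sets.sigma_sets_subset) auto
    then show ?thesis using B by (simp add: subalgebra_def)
  qed
  show ?thesis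
    unfolding indep_var_eq
    using measurable_from_subalg[OF A X] measurable_from_subalg[OF B Y] ind sA sB
    unfolding indep_sets2_eq by blast
qed

text \<open>Expanding the inner product over the basis leaves products of independent real
  variables, one factor of which is centred.\<close>

lemma (in prob_space) integral_inner_indep_zero:
  fixes X Y :: "'a \<Rightarrow> 'b::euclidean_space"
  assumes "indep_set (sets A) (sets B)" "subalgebra M A" "subalgebra M B"
    and X: "X \<in> borel_measurable A" "integrable M X"
    and Y: "Y \<in> borel_measurable B" "integrable M Y" "(\<integral>\<omega>. Y \<omega> \<partial>M) = 0"
  shows "(\<integral>\<omega>. X \<omega> \<bullet> Y \<omega> \<partial>M) = 0"
proof -
  have iv: "indep_var borel (\<lambda>\<omega>. X \<omega> \<bullet> b) borel (\<lambda>\<omega>. Y \<omega> \<bullet> b)" for b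
    using X(1) Y(1) by (intro indep_set_imp_indep_var[OF assms(1-3)]) auto
  have "(\<integral>\<omega>. X \<omega> \<bullet> Y \<omega> \<partial>M) = (\<Sum>b\<in>Basis. \<integral>\<omega>. (X \<omega> \<bullet> b) * (Y \<omega> \<bullet> b) \<partial>M)"
    unfolding euclidean_inner[of "X _" "Y _"]
    using X(2) Y(2) by (intro Bochner_Integration.integral_sum indep_var_integrable[OF iv]) auto
  also have "\<dots> = (\<Sum>b\<in>Basis. (\<integral>\<omega>. X \<omega> \<bullet> b \<partial>M) * ((\<integral>\<omega>. Y \<omega> \<partial>M) \<bullet> b))"
    using X(2) Y(2) by (intro sum.cong refl) (simp add: indep_var_lebesgue_integral[OF iv])
  finally show ?thesis by (simp add: Y(3))
qed

text \<open>The integrand pairs \<open>Y\<close> with a power multiple of \<open>X\<close>, which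
  inherits measurability from \<open>X\<close> and is integrable by \<open>Hoelder_three\<close>
  with the constant \<open>1\<close> as third function.\<close>

lemma (in prob_space) dual_map_indep_zero:
  fixes X Y :: "'a \<Rightarrow> 'b::euclidean_space"
  assumes "indep_set (sets A) (sets B)" "subalgebra M A" "subalgebra M B" and p: "2 \<le> p"
    and X: "X \<in> borel_measurable A" "Lp M p X"
    and Y: "Y \<in> borel_measurable B" "Lp M p Y" "(\<integral>\<omega>. Y \<omega> \<partial>M) = 0"
  shows "dual_map M p X Y = 0"
proof -
  note [measurable] = X(1) Lp_measurable[OF X(2)]
  have "integrable M (\<lambda>\<omega>. norm (X \<omega>) powr (p - 2) * norm (X \<omega>) * norm (1::real))"
    by (rule Hoelder_three(1)[OF p X(2) X(2) Lp_const(1)]) (use p in simp)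
  then have "integrable M (\<lambda>\<omega>. norm (norm (X \<omega>) powr (p - 2) *\<^sub>R X \<omega>))" by simp
  then have "integrable M (\<lambda>\<omega>. norm (X \<omega>) powr (p - 2) *\<^sub>R X \<omega>)"
    by (subst (asm) integrable_norm_iff) auto
  then show ?thesis
    unfolding dual_map_def
    using integral_inner_indep_zero[OF assms(1-3) _ _ Y(1) Lp_imp_integrable(1)[OF p Y(2)] Y(3),
        of "\<lambda>\<omega>. norm (X \<omega>) powr (p - 2) *\<^sub>R X \<omega>"]
    by simp
qed

text \<open>Bound \<open>a j * a n\<close> by half the sum of the squares. In the half with
  \<open>a n\<close> the lags are summed over \<open>j\<close>, in the other, after exchanging the
  sums, over \<open>n\<close>; either way each lag occurs once and \<open>G\<close> bounds the
  sum.\<close>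

lemma sum_weighted_lag_le:
  fixes a g :: "nat \<Rightarrow> real"
  assumes g: "\<And>\<tau>. 0 \<le> g \<tau>" "\<And>N. (\<Sum>\<tau><N. g \<tau>) \<le> G"
  shows "(\<Sum>n<N. \<Sum>j<Suc n. a j * a n * g (n - j)) \<le> G * (\<Sum>n<N. (a n)\<^sup>2)"
proof -
  have "(\<Sum>n<N. \<Sum>j<Suc n. a j * a n * g (n - j))
      \<le> (\<Sum>n<N. \<Sum>j<Suc n. ((a n)\<^sup>2 / 2 * g (n - j) + (a j)\<^sup>2 / 2 * g (n - j)))"
  proof (intro sum_mono)
    fix n j
    have "a j * a n \<le> (a n)\<^sup>2 / 2 + (a j)\<^sup>2 / 2" using sum_squares_bound[of "a j" "a n"] by simp
    then show "a j * a n * g (n - j) \<le> (a n)\<^sup>2 / 2 * g (n - j) + (a j)\<^sup>2 / 2 * g (n - j)"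
      using g(1) using mult_right_mono[of "a j * a n" "(a n)\<^sup>2 / 2 + (a j)\<^sup>2 / 2" "g (n - j)"]
      by (simp only: distrib_right)
  qed
  also have "\<dots> = (\<Sum>n<N. (a n)\<^sup>2 / 2 * (\<Sum>j<Suc n. g (n - j))) + (\<Sum>n<N. \<Sum>j<Suc n. (a j)\<^sup>2 / 2 * g (n - j))"
    by (simp only: sum.distrib sum_distrib_left)
  also have "(\<Sum>n<N. \<Sum>j<Suc n. (a j)\<^sup>2 / 2 * g (n - j)) = (\<Sum>j<N. (a j)\<^sup>2 / 2 * (\<Sum>n\<in>{j..<N}. g (n - j)))"
  proof -
    have "(\<Sum>n<N. \<Sum>j<Suc n. (a j)\<^sup>2 / 2 * g (n - j))
        = (\<Sum>n<N. \<Sum>j\<in>{j\<in>{..<N}. j \<le> n}. (a j)\<^sup>2 / 2 * g (n - j))"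
      by (intro sum.cong refl) auto
    also have "\<dots> = (\<Sum>j<N. \<Sum>n\<in>{n\<in>{..<N}. j \<le> n}. (a j)\<^sup>2 / 2 * g (n - j))"
      by (rule sum.swap_restrict) auto
    also have "\<dots> = (\<Sum>j<N. (a j)\<^sup>2 / 2 * (\<Sum>n\<in>{j..<N}. g (n - j)))"
      unfolding sum_distrib_left by (intro sum.cong refl) auto
    finally show ?thesis .
  qed
  also have "(\<Sum>n<N. (a n)\<^sup>2 / 2 * (\<Sum>j<Suc n. g (n - j))) \<le> (\<Sum>n<N. (a n)\<^sup>2 / 2 * G)"
  proof (intro sum_mono mult_left_mono)
    fix n
    have "(\<Sum>j<Suc n. g (n - j)) = (\<Sum>\<tau><Suc n. g \<tau>)"
      using sum.nat_diff_reindex[of g "Suc n"] by simp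
    then show "(\<Sum>j<Suc n. g (n - j)) \<le> G" using g(2)[of "Suc n"] by simp
  qed simp
  also have "(\<Sum>j<N. (a j)\<^sup>2 / 2 * (\<Sum>n\<in>{j..<N}. g (n - j))) \<le> (\<Sum>j<N. (a j)\<^sup>2 / 2 * G)"
  proof (intro sum_mono mult_left_mono)
    fix j assume "j \<in> {..<N}"
    then have "(\<Sum>n\<in>{j..<N}. g (n - j)) = (\<Sum>\<tau><N - j. g \<tau>)"
      using sum.shift_bounds_nat_ivl[of "\<lambda>n. g (n - j)" 0 j "N - j"] by (simp add: lessThan_atLeast0)
    then show "(\<Sum>n\<in>{j..<N}. g (n - j)) \<le> G" using g(2)[of "N - j"] by simp
  qed simp
  also have "(\<Sum>n<N. (a n)\<^sup>2 / 2 * G) + (\<Sum>j<N. (a j)\<^sup>2 / 2 * G) = G * (\<Sum>n<N. (a n)\<^sup>2)"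
    by (simp add: sum_distrib_left flip: sum.distrib)
  finally show ?thesis by simp
qed

text \<open>The weights \<open>a\<close> scale the size of \<open>\<xi> n\<close> and its
  approximation error alike, so that one statement covers filtered sums, where \<open>a\<close> is
  the modulus of the coefficients, and sums of matrices, where \<open>a\<close> is
  \<open>1\<close>.\<close>

theorem (in prob_space) Lq_norm_square_mixing_sum_le:
  fixes \<xi> :: "nat \<Rightarrow> 'a \<Rightarrow> 'b::euclidean_space"
  assumes p: "2 \<le> p" and FP: "filtration_pair M F Fp"
    and \<xi>: "\<And>n. \<xi> n \<in> borel_measurable (F n)" "\<And>n. Lp M p (\<xi> n)" "\<And>n. Lq_norm M p (\<xi> n) \<le> a n * m"
    and a: "\<And>n. 0 \<le> a n" and m: "0 \<le> m"
    and approx: "\<And>n j. j \<le> n \<Longrightarrow> \<exists>\<eta>. \<eta> \<in> borel_measurable (Fp j) \<and> Lp M p \<eta> \<and> (\<integral>\<omega>. \<eta> \<omega> \<partial>M) = 0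
        \<and> Lq_norm M p (\<lambda>\<omega>. \<xi> n \<omega> - \<eta> \<omega>) \<le> a n * g (n - j)"
    and g: "\<And>\<tau>. 0 \<le> g \<tau>" "\<And>N. (\<Sum>\<tau><N. g \<tau>) \<le> G"
  shows "(Lq_norm M p (\<lambda>\<omega>. \<Sum>n<N. \<xi> n \<omega>))\<^sup>2 \<le> 6 * (p - 1) * m * G * (\<Sum>n<N. (a n)\<^sup>2)"
proof -
  have p1: "1 \<le> p" using p by simp
  define S where "S n = (\<lambda>\<omega>. \<Sum>i<n. \<xi> i \<omega>)" for n
  have SL: "Lp M p (S n)" for n
    unfolding S_def using Lq_norm_sum[OF p1, of "{..<n}" M \<xi>] \<xi>(2) by blast
  have sub: "subalgebra M (F j)" "subalgebra M (Fp j)" "indep_set (sets (F j)) (sets (Fp j))" for j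
    using FP by (auto simp: filtration_pair_def)
  have mono: "f \<in> borel_measurable (F j)" if "f \<in> borel_measurable (F i)" "i \<le> j" for f :: "'a \<Rightarrow> 'b" and i j
  proof (rule measurable_from_subalg[OF _ that(1)])
    show "subalgebra (F j) (F i)"
      using that(2) sub(1)[of i] sub(1)[of j] FP by (auto simp: filtration_pair_def subalgebra_def)
  qed
  \<comment> \<open>\<open>S (Suc j)\<close> ends with \<open>\<xi> j\<close>, so it is still
    measurable with respect to \<open>F j\<close> and, like \<open>S j\<close>, independent of
    \<open>Fp j\<close>.\<close>
  have Sm: "S n \<in> borel_measurable (F j)" if "n \<le> Suc j" for n j
    unfolding S_def using that by (intro borel_measurable_sum mono[OF \<xi>(1)]) auto
  have lag: "dual_map M p (S (Suc j)) (\<xi> n) - dual_map M p (S j) (\<xi> n)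
      \<le> 6 * (p - 1) * m * (a j * a n * g (n - j))" if "j \<le> n" for n j
  proof -
    obtain \<eta> where \<eta>: "\<eta> \<in> borel_measurable (Fp j)" "Lp M p \<eta>" "(\<integral>\<omega>. \<eta> \<omega> \<partial>M) = 0"
      "Lq_norm M p (\<lambda>\<omega>. \<xi> n \<omega> - \<eta> \<omega>) \<le> a n * g (n - j)"
      using approx[OF \<open>j \<le> n\<close>] by blast
    let ?H = "\<lambda>\<omega>. \<xi> n \<omega> - \<eta> \<omega>"
    have z: "dual_map M p (S i) \<eta> = 0" if "i \<le> Suc j" for i
      by (rule dual_map_indep_zero[OF sub(3) sub(1,2) p Sm[OF that] SL \<eta>(1-3)])
    have H: "Lp M p ?H" using Lq_norm_diff(1)[OF p1 \<xi>(2) \<eta>(2)] .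
    have "dual_map M p (S (Suc j)) (\<xi> n) - dual_map M p (S j) (\<xi> n)
        = dual_map M p (S (Suc j)) ?H - dual_map M p (S j) ?H"
      by (simp add: dual_map_diff[OF p SL \<xi>(2) \<eta>(2)] z)
    also have "\<dots> \<le> 6 * (p - 1) * Lq_norm M p (\<lambda>\<omega>. S (Suc j) \<omega> - S j \<omega>) * Lq_norm M p ?H"
      using dual_map_lipschitz[OF p SL SL H, of "Suc j" j] by simp
    also have "(\<lambda>\<omega>. S (Suc j) \<omega> - S j \<omega>) = \<xi> j" by (simp add: S_def)
    also have "6 * (p - 1) * Lq_norm M p (\<xi> j) * Lq_norm M p ?H \<le> 6 * (p - 1) * (a j * m) * (a n * g (n - j))"
      using p a m g(1) \<eta>(4) \<xi>(3) by (intro mult_mono) auto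
    finally show ?thesis by (simp add: ac_simps)
  qed
  have inc: "(Lq_norm M p (S (Suc n)))\<^sup>2 - (Lq_norm M p (S n))\<^sup>2
      \<le> (\<Sum>j<Suc n. 6 * (p - 1) * m * (a j * a n * g (n - j)))" for n
  proof -
    have "(Lq_norm M p (S (Suc n)))\<^sup>2 - (Lq_norm M p (S n))\<^sup>2 \<le> dual_map M p (S (Suc n)) (\<lambda>\<omega>. S (Suc n) \<omega> - S n \<omega>)"
      by (rule Lq_norm_square_diff_le_dual_map[OF p SL SL])
    also have "(\<lambda>\<omega>. S (Suc n) \<omega> - S n \<omega>) = \<xi> n" by (simp add: S_def)
    \<comment> \<open>The telescoping sum starts at \<open>S 0\<close>, the zero function, where the
      functional is \<open>0\<close>.\<close>
    also have "dual_map M p (S (Suc n)) (\<xi> n)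
        = (\<Sum>j<Suc n. dual_map M p (S (Suc j)) (\<xi> n) - dual_map M p (S j) (\<xi> n))"
      by (subst sum_lessThan_telescope) (simp add: S_def dual_map_def)
    also have "\<dots> \<le> (\<Sum>j<Suc n. 6 * (p - 1) * m * (a j * a n * g (n - j)))"
      by (intro sum_mono lag) simp
    finally show ?thesis .
  qed
  have "(Lq_norm M p (S N))\<^sup>2 = (\<Sum>n<N. (Lq_norm M p (S (Suc n)))\<^sup>2 - (Lq_norm M p (S n))\<^sup>2)"
    by (subst sum_lessThan_telescope) (simp add: S_def Lp_zero)
  also have "\<dots> \<le> (\<Sum>n<N. \<Sum>j<Suc n. 6 * (p - 1) * m * (a j * a n * g (n - j)))"
    by (intro sum_mono inc)
  also have "\<dots> = 6 * (p - 1) * m * (\<Sum>n<N. \<Sum>j<Suc n. a j * a n * g (n - j))"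
    by (simp only: sum_distrib_left)
  also have "\<dots> \<le> 6 * (p - 1) * m * (G * (\<Sum>n<N. (a n)\<^sup>2))"
    using p m by (intro mult_left_mono sum_weighted_lag_le g) auto
  finally show ?thesis by (simp add: S_def ac_simps)
qed

section \<open>Conditional expectations in moment spaces\<close>

text \<open>Conditional Jensen for the convex function \<open>\<bar>t\<bar> powr p\<close>,
  integrated.\<close>

lemma (in prob_space) Lp_real_cond_exp:
  fixes X :: "'a \<Rightarrow> real"
  assumes G: "subalgebra M G" and p: "2 \<le> p" and X: "Lp M p X"
  shows "Lp M p (real_cond_exp M G X)" "Lq_norm M p (real_cond_exp M G X) \<le> Lq_norm M p X"
proof -
  interpret finite_measure_subalgebra M G
    using G by unfold_locales
  have iX: "integrable M X" using Lp_imp_integrable(1)[OF p X] .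
  have ip: "integrable M (\<lambda>\<omega>. \<bar>X \<omega>\<bar> powr p)" using Lp_integrable[OF X] by simp
  have cvx: "convex_on UNIV (\<lambda>t::real. \<bar>t\<bar> powr p)"
  proof (rule convex_onI)
    fix t x y :: real assume t: "0 < t" "t < 1"
    have "\<bar>(1 - t) * x + t * y\<bar> powr p \<le> (t * \<bar>y\<bar> + (1 - t) * \<bar>x\<bar>) powr p"
      using p t abs_triangle_ineq[of "(1 - t) * x" "t * y"] by (intro powr_mono2) (auto simp: abs_mult)
    also have "\<dots> \<le> t * \<bar>y\<bar> powr p + (1 - t) * \<bar>x\<bar> powr p"
      using t p by (intro powr_convex_combination) auto
    finally show "\<bar>(1 - t) *\<^sub>R x + t *\<^sub>R y\<bar> powr p \<le> (1 - t) * \<bar>x\<bar> powr p + t * \<bar>y\<bar> powr p" by simp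
  qed simp
  have J: "AE \<omega> in M. \<bar>real_cond_exp M G X \<omega>\<bar> powr p \<le> real_cond_exp M G (\<lambda>\<omega>. \<bar>X \<omega>\<bar> powr p) \<omega>"
    by (rule real_cond_exp_jensens_inequality(2)[OF iX _ _ ip cvx]) auto
  have i: "integrable M (\<lambda>\<omega>. \<bar>real_cond_exp M G X \<omega>\<bar> powr p)"
  proof (rule Bochner_Integration.integrable_bound[OF real_cond_exp_int(1)[OF ip]])
    show "AE \<omega> in M. norm (\<bar>real_cond_exp M G X \<omega>\<bar> powr p) \<le> norm (real_cond_exp M G (\<lambda>\<omega>. \<bar>X \<omega>\<bar> powr p) \<omega>)"
      using J by eventually_elim simp
  qed simp
  then show "Lp M p (real_cond_exp M G X)" by (simp add: Lp_def)
  have "(\<integral>\<omega>. \<bar>real_cond_exp M G X \<omega>\<bar> powr p \<partial>M) \<le> (\<integral>\<omega>. real_cond_exp M G (\<lambda>\<omega>. \<bar>X \<omega>\<bar> powr p) \<omega> \<partial>M)"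
    by (rule integral_mono_AE[OF i real_cond_exp_int(1)[OF ip] J])
  also have "\<dots> = (\<integral>\<omega>. \<bar>X \<omega>\<bar> powr p \<partial>M)" by (rule real_cond_exp_int(2)[OF ip])
  also have "\<dots> = Lq_norm M p X powr p" using p by (simp add: Lq_norm_powr)
  finally show "Lq_norm M p (real_cond_exp M G X) \<le> Lq_norm M p X"
    using p by (intro Lq_norm_leI) auto
qed

text \<open>As a finite sum of scalars times fixed vectors, a vector-valued map takes over
  measurability and moment bounds from its components.\<close>

lemma vec_eq_sum_axis: "(\<chi> i. f i) = (\<Sum>i\<in>UNIV. f i *\<^sub>R axis i (1::real))"
  by (simp add: vec_eq_iff axis_def if_distrib cong: if_cong)

lemma cond_exp_vec_measurable: "cond_exp_vec P G X \<in> borel_measurable G"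
  unfolding cond_exp_vec_def vec_eq_sum_axis by measurable

text \<open>Componentwise from the real case, hence the factor \<open>CARD('n)\<close>. It is
  harmless, since the norm bound only serves to show that the supremum in \<open>gamma_q\<close> is
  finite.\<close>

lemma (in prob_space) Lp_cond_exp_vec:
  fixes X :: "'a \<Rightarrow> real ^ 'n"
  assumes G: "subalgebra M G" and p: "2 \<le> p" and X: "Lp M p X"
  shows "Lp M p (cond_exp_vec M G X)" "Lq_norm M p (cond_exp_vec M G X) \<le> CARD('n) * Lq_norm M p X"
    and "(\<integral>\<omega>. cond_exp_vec M G X \<omega> \<partial>M) = (\<integral>\<omega>. X \<omega> \<partial>M)"
proof -
  interpret finite_measure_subalgebra M G
    using G by unfold_locales
  have p1: "1 \<le> p" "0 < p" using p by auto
  note [measurable] = Lp_measurable[OF X]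
  have Xi: "Lp M p (\<lambda>\<omega>. X \<omega> $ i)" "Lq_norm M p (\<lambda>\<omega>. X \<omega> $ i) \<le> Lq_norm M p X" for i
  proof -
    have m: "(\<lambda>\<omega>. X \<omega> $ i) \<in> borel_measurable M"
      by (rule borel_measurable_continuous_on[of "\<lambda>v. v $ i"]) (auto intro: continuous_intros)
    have "norm (X \<omega> $ i) \<le> 1 * norm (X \<omega>)" for \<omega>
      using component_le_norm_cart[of "X \<omega>" i] by simp
    from Lp_mono[OF p1(2) X m this] show "Lp M p (\<lambda>\<omega>. X \<omega> $ i)" "Lq_norm M p (\<lambda>\<omega>. X \<omega> $ i) \<le> Lq_norm M p X"
      by auto
  qed
  let ?c = "\<lambda>i \<omega>. real_cond_exp M G (\<lambda>\<eta>. X \<eta> $ i) \<omega> *\<^sub>R axis i (1::real)"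
  have eq: "cond_exp_vec M G X = (\<lambda>\<omega>. \<Sum>i\<in>UNIV. ?c i \<omega>)"
    unfolding cond_exp_vec_def vec_eq_sum_axis ..
  have c: "Lp M p (?c i)" "Lq_norm M p (?c i) \<le> Lq_norm M p X" for i
    using Lp_real_cond_exp[OF G p Xi(1)[of i]] Xi(2)[of i]
      Lp_mono[OF p1(2) Lp_real_cond_exp(1)[OF G p Xi(1)[of i]], of "?c i" 1] by auto
  have s: "Lp M p (\<lambda>\<omega>. \<Sum>i\<in>UNIV. ?c i \<omega>)" "Lq_norm M p (\<lambda>\<omega>. \<Sum>i\<in>UNIV. ?c i \<omega>) \<le> (\<Sum>i\<in>UNIV. Lq_norm M p (?c i))"
    using Lq_norm_sum[OF p1(1), of UNIV M ?c] c(1) by auto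
  show "Lp M p (cond_exp_vec M G X)" unfolding eq by (rule s)
  have "(\<Sum>i\<in>UNIV. Lq_norm M p (?c i)) \<le> (\<Sum>i\<in>(UNIV::'n set). Lq_norm M p X)"
    by (intro sum_mono c)
  then show "Lq_norm M p (cond_exp_vec M G X) \<le> CARD('n) * Lq_norm M p X"
    unfolding eq using s(2) by simp
  have iX: "integrable M (\<lambda>\<omega>. X \<omega> $ i)" for i using Lp_imp_integrable(1)[OF p Xi(1)] .
  have "(\<integral>\<omega>. cond_exp_vec M G X \<omega> \<partial>M) = (\<Sum>i\<in>UNIV. (\<integral>\<omega>. X \<omega> $ i \<partial>M) *\<^sub>R axis i (1::real))"
    unfolding eq using real_cond_exp_int[OF iX] by (subst Bochner_Integration.integral_sum) auto
  also have "\<dots> = (\<chi> i. \<integral>\<omega>. X \<omega> $ i \<partial>M)" by (rule vec_eq_sum_axis[symmetric])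
  also have "\<dots> = (\<integral>\<omega>. X \<omega> \<partial>M)"
    using Lp_imp_integrable(1)[OF p X]
    by (simp add: vec_eq_iff integral_bounded_linear[OF bounded_linear_vec_nth])
  finally show "(\<integral>\<omega>. cond_exp_vec M G X \<omega> \<partial>M) = (\<integral>\<omega>. X \<omega> \<partial>M)" .
qed

section \<open>Linear functionals of an L-mixing process\<close>

text \<open>Both sides are integrals of \<open>\<Phi>\<close> against laws on path space, which
  stationarity identifies.\<close>

lemma integral_stationary_shift:
  fixes y :: "nat \<Rightarrow> 'a \<Rightarrow> real ^ 'n" and \<Phi> :: "(nat \<Rightarrow> real ^ 'n) \<Rightarrow> 'b::{banach, second_countable_topology}"
  assumes st: "stationary P y" and y: "\<And>k. y k \<in> borel_measurable P"
    and \<Phi>: "\<Phi> \<in> borel_measurable (PiM UNIV (\<lambda>_. borel))"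
  shows "(\<integral>\<omega>. \<Phi> (\<lambda>k. y (k + m) \<omega>) \<partial>P) = (\<integral>\<omega>. \<Phi> (\<lambda>k. y k \<omega>) \<partial>P)"
proof -
  have "(\<lambda>\<omega> k. y (k + j) \<omega>) \<in> measurable P (PiM UNIV (\<lambda>_. borel))" for j
    using y by (intro measurable_PiM_single') (auto simp: space_PiM)
  from integral_distr[OF this \<Phi>] have
    "(\<integral>\<omega>. \<Phi> (\<lambda>k. y (k + j) \<omega>) \<partial>P) = integral\<^sup>L (distr P (PiM UNIV (\<lambda>_. borel)) (\<lambda>\<omega> k. y (k + j) \<omega>)) \<Phi>" for j
    by simp
  from this[of m] this[of 0] st show ?thesis by (simp add: stationary_def)
qed

lemma bounded_linear_cvec: "bounded_linear (\<lambda>v. c *s cvec v)"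
  unfolding linear_conv_bounded_linear[symmetric]
  by (auto simp: linear_iff cvec_def vec_eq_iff algebra_simps scaleR_conv_of_real[where 'a=complex])

lemma norm_scale_cvec: "norm (c *s cvec v) = cmod c * norm v"
  by (simp add: norm_vec_def cvec_def norm_mult L2_set_right_distrib)

lemma measurable_scale_cvec [measurable (raw)]:
  assumes "f \<in> borel_measurable A"
  shows "(\<lambda>\<omega>. c *s cvec (f \<omega>)) \<in> borel_measurable A"
  by (rule borel_measurable_continuous_on[OF linear_continuous_on[OF bounded_linear_cvec] assms])

locale L_mixing_process = prob_space M for M :: "'a measure" +
  fixes F Fp :: "nat \<Rightarrow> 'a measure" and y :: "nat \<Rightarrow> 'a \<Rightarrow> real ^ 'n"
  assumes filtration: "filtration_pair M F Fp" and mixing: "L_mixing M F Fp y"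
begin

lemma y_measurable_F: "y n \<in> borel_measurable (F n)"
  using mixing by (simp add: L_mixing_def)

lemma subalgebra_F: "subalgebra M (F n)" "subalgebra M (Fp n)"
  using filtration by (auto simp: filtration_pair_def)

lemma measurable_F_mono:
  assumes "f \<in> measurable (F i) N" "i \<le> j"
  shows "f \<in> measurable (F j) N"
proof (rule measurable_from_subalg[OF _ assms(1)])
  show "subalgebra (F j) (F i)"
    using assms(2) subalgebra_F(1)[of i] subalgebra_F(1)[of j] filtration
    by (auto simp: filtration_pair_def subalgebra_def)
qed

lemma y_measurable [measurable]: "y n \<in> borel_measurable M"
  using measurable_from_subalg[OF subalgebra_F(1) y_measurable_F] .

lemma Lp_y: "1 \<le> p \<Longrightarrow> Lp M p (y n)"
  using mixing by (simp add: L_mixing_def Lp_def)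

lemma Lq_norm_y_le: "1 \<le> p \<Longrightarrow> Lq_norm M p (y n) \<le> Mq M p y"
  using mixing unfolding Mq_def L_mixing_def by (intro cSUP_upper) auto

lemma Mq_nonneg: "1 \<le> p \<Longrightarrow> 0 \<le> Mq M p y"
  using order_trans[OF Lq_norm_nonneg Lq_norm_y_le] .

text \<open>A real \<open>SUP\<close> is known to dominate its members only over a bounded set, so
  boundedness comes first: each error is at most \<open>1 + CARD('n)\<close> times
  \<open>Mq\<close>. At lag \<open>n - j\<close> the index \<open>n - (n - j)\<close> of the
  conditioning is \<open>j\<close>.\<close>

lemma Lq_norm_cond_exp_le_gamma:
  assumes p: "2 \<le> p" and "j \<le> n"
  shows "Lq_norm M p (\<lambda>\<omega>. y n \<omega> - cond_exp_vec M (Fp j) (y n) \<omega>) \<le> gamma_q M Fp p (n - j) y"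
proof -
  have p1: "1 \<le> p" using p by simp
  have "Lq_norm M p (\<lambda>\<omega>. y k \<omega> - cond_exp_vec M (Fp i) (y k) \<omega>) \<le> Mq M p y + CARD('n) * Mq M p y" for k i
  proof -
    have "Lq_norm M p (\<lambda>\<omega>. y k \<omega> - cond_exp_vec M (Fp i) (y k) \<omega>)
        \<le> Lq_norm M p (y k) + Lq_norm M p (cond_exp_vec M (Fp i) (y k))"
      by (rule Lq_norm_diff(2)[OF p1 Lp_y[OF p1] Lp_cond_exp_vec(1)[OF subalgebra_F(2) p Lp_y[OF p1]]])
    also have "\<dots> \<le> Lq_norm M p (y k) + CARD('n) * Lq_norm M p (y k)"
      by (intro add_left_mono Lp_cond_exp_vec(2)[OF subalgebra_F(2) p Lp_y[OF p1]])
    also have "\<dots> \<le> Mq M p y + CARD('n) * Mq M p y"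
      using Lq_norm_y_le[OF p1] by (intro add_mono mult_left_mono) auto
    finally show ?thesis .
  qed
  then have "bdd_above ((\<lambda>k. Lq_norm M p (\<lambda>\<omega>. y k \<omega> - cond_exp_vec M (Fp (k - (n - j))) (y k) \<omega>)) ` {n - j..})"
    by (intro bdd_aboveI2)
  then have "Lq_norm M p (\<lambda>\<omega>. y n \<omega> - cond_exp_vec M (Fp (n - (n - j))) (y n) \<omega>) \<le> gamma_q M Fp p (n - j) y"
    unfolding gamma_q_def by (rule cSUP_upper[rotated]) simp
  then show ?thesis using assms by simp
qed

lemma gamma_nonneg:
  assumes "2 \<le> p"
  shows "0 \<le> gamma_q M Fp p \<tau> y"
  using order_trans[OF Lq_norm_nonneg Lq_norm_cond_exp_le_gamma[OF assms, of 0 \<tau>]] by simp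

lemma sum_gamma_le: "2 \<le> p \<Longrightarrow> (\<Sum>\<tau><N. gamma_q M Fp p \<tau> y) \<le> Gamma_dq M Fp p y"
  unfolding Gamma_dq_def using mixing by (intro sum_le_suminf) (auto simp: L_mixing_def gamma_nonneg)

lemma Gamma_nonneg: "2 \<le> p \<Longrightarrow> 0 \<le> Gamma_dq M Fp p y"
  using sum_gamma_le[of p 0] by simp

lemma Lp_centered_cvec:
  assumes "1 \<le> p"
  shows "Lp M p (\<lambda>\<omega>. c *s cvec (y n \<omega> - \<mu>))"
proof -
  have "Lp M p (\<lambda>\<omega>. y n \<omega> - \<mu>)"
    using assms by (intro Lq_norm_diff(1)[OF assms Lp_y[OF assms] Lp_const(1)]) simp
  from Lp_mono(1)[OF _ this measurable_scale_cvec[OF Lp_measurable[OF this]], of c "cmod c"] assms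
  show ?thesis by (simp add: norm_scale_cvec)
qed

text \<open>The mixing inequality with weights \<open>cmod (\<alpha> n)\<close>, lags
  \<open>gamma_q\<close> and approximants built from the centred conditional expectation of
  \<open>y n\<close>. Centring doubles the moment bound, which yields the constant
  \<open>12\<close>, rounded up to \<open>16 = 4 * 4\<close>.\<close>

lemma Lq_norm_weighted_sum_le:
  assumes p: "2 \<le> p" and \<mu>: "\<And>n. (\<integral>\<omega>. y n \<omega> \<partial>M) = \<mu>"
  shows "Lq_norm M p (\<lambda>\<omega>. \<Sum>n<N. \<alpha> n *s cvec (y n \<omega> - \<mu>))
    \<le> 4 * sqrt ((p - 1) * Mq M p y * Gamma_dq M Fp p y) * sqrt (\<Sum>n<N. (cmod (\<alpha> n))\<^sup>2)"
proof -
  have p1: "1 \<le> p" "0 < p" using p by auto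
  let ?m = "Mq M p y" and ?G = "Gamma_dq M Fp p y"
  note cont = measurable_scale_cvec
  have sc: "Lp M p (\<lambda>\<omega>. c *s cvec (X \<omega>)) \<and> Lq_norm M p (\<lambda>\<omega>. c *s cvec (X \<omega>)) \<le> cmod c * Lq_norm M p X"
    if "Lp M p X" for c and X :: "'a \<Rightarrow> real ^ 'n"
    using Lp_mono[OF p1(2) that cont[OF Lp_measurable[OF that]], of c "cmod c"] by (simp add: norm_scale_cvec)
  have "norm \<mu> \<le> ?m"
    using Lp_imp_integrable(2)[OF p Lp_y[OF p1(1), of 0]] Lq_norm_y_le[OF p1(1), of 0] \<mu> by simp
  then have ym: "Lp M p (\<lambda>\<omega>. y n \<omega> - \<mu>)" "Lq_norm M p (\<lambda>\<omega>. y n \<omega> - \<mu>) \<le> 2 * ?m" for n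
    using Lq_norm_diff[OF p1(1) Lp_y[OF p1(1), of n] Lp_const(1)[OF p1(2)], of \<mu>]
      Lp_const(2)[OF p1(2), of \<mu>] Lq_norm_y_le[OF p1(1), of n] by auto
  have "(Lq_norm M p (\<lambda>\<omega>. \<Sum>n<N. \<alpha> n *s cvec (y n \<omega> - \<mu>)))\<^sup>2
      \<le> 6 * (p - 1) * (2 * ?m) * ?G * (\<Sum>n<N. (cmod (\<alpha> n))\<^sup>2)"
  proof (rule Lq_norm_square_mixing_sum_le[OF p filtration])
    fix n
    show "(\<lambda>\<omega>. \<alpha> n *s cvec (y n \<omega> - \<mu>)) \<in> borel_measurable (F n)"
      by (intro cont borel_measurable_diff y_measurable_F) simp
    show "Lp M p (\<lambda>\<omega>. \<alpha> n *s cvec (y n \<omega> - \<mu>))" using sc[OF ym(1)] by simp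
    have "Lq_norm M p (\<lambda>\<omega>. \<alpha> n *s cvec (y n \<omega> - \<mu>)) \<le> cmod (\<alpha> n) * Lq_norm M p (\<lambda>\<omega>. y n \<omega> - \<mu>)"
      using sc[OF ym(1)] by simp
    also have "\<dots> \<le> cmod (\<alpha> n) * (2 * ?m)" using ym(2) by (intro mult_left_mono) auto
    finally show "Lq_norm M p (\<lambda>\<omega>. \<alpha> n *s cvec (y n \<omega> - \<mu>)) \<le> cmod (\<alpha> n) * (2 * ?m)" .
  next
    fix n j :: nat assume jn: "j \<le> n"
    define C where "C = cond_exp_vec M (Fp j) (y n)"
    note ce = Lp_cond_exp_vec[OF subalgebra_F(2)[of j] p Lp_y[OF p1(1), of n], folded C_def]
    have Cm: "Lp M p (\<lambda>\<omega>. C \<omega> - \<mu>)"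
      by (rule Lq_norm_diff(1)[OF p1(1) ce(1) Lp_const(1)[OF p1(2)]])
    have int: "(\<integral>\<omega>. \<alpha> n *s cvec (C \<omega> - \<mu>) \<partial>M) = \<alpha> n *s cvec (\<integral>\<omega>. C \<omega> - \<mu> \<partial>M)"
      by (rule integral_bounded_linear[OF bounded_linear_cvec Lp_imp_integrable(1)[OF p Cm]])
    have "(\<integral>\<omega>. C \<omega> - \<mu> \<partial>M) = 0"
      using Lp_imp_integrable(1)[OF p ce(1)] ce(3) \<mu> by (simp add: prob_space)
    then have "(\<integral>\<omega>. \<alpha> n *s cvec (C \<omega> - \<mu>) \<partial>M) = 0"
      unfolding int by (simp add: cvec_def vec_eq_iff)
    moreover have "(\<lambda>\<omega>. \<alpha> n *s cvec (C \<omega> - \<mu>)) \<in> borel_measurable (Fp j)"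
      unfolding C_def by (intro cont borel_measurable_diff cond_exp_vec_measurable) simp
    moreover have "Lp M p (\<lambda>\<omega>. \<alpha> n *s cvec (C \<omega> - \<mu>))" using sc[OF Cm] by simp
    moreover have "Lq_norm M p (\<lambda>\<omega>. \<alpha> n *s cvec (y n \<omega> - \<mu>) - \<alpha> n *s cvec (C \<omega> - \<mu>))
        \<le> cmod (\<alpha> n) * gamma_q M Fp p (n - j) y"
    proof -
      have "(\<lambda>\<omega>. \<alpha> n *s cvec (y n \<omega> - \<mu>) - \<alpha> n *s cvec (C \<omega> - \<mu>)) = (\<lambda>\<omega>. \<alpha> n *s cvec (y n \<omega> - C \<omega>))"
        by (simp add: linear_diff[OF bounded_linear.linear[OF bounded_linear_cvec], symmetric])
      moreover have "Lq_norm M p (\<lambda>\<omega>. \<alpha> n *s cvec (y n \<omega> - C \<omega>)) \<le> cmod (\<alpha> n) * Lq_norm M p (\<lambda>\<omega>. y n \<omega> - C \<omega>)"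
        using sc[OF Lq_norm_diff(1)[OF p1(1) Lp_y[OF p1(1)] ce(1)]] by simp
      moreover have "cmod (\<alpha> n) * Lq_norm M p (\<lambda>\<omega>. y n \<omega> - C \<omega>) \<le> cmod (\<alpha> n) * gamma_q M Fp p (n - j) y"
        unfolding C_def by (intro mult_left_mono Lq_norm_cond_exp_le_gamma p jn) simp
      ultimately show ?thesis by simp
    qed
    ultimately show "\<exists>\<eta>. \<eta> \<in> borel_measurable (Fp j) \<and> Lp M p \<eta> \<and> (\<integral>\<omega>. \<eta> \<omega> \<partial>M) = 0 \<and>
        Lq_norm M p (\<lambda>\<omega>. \<alpha> n *s cvec (y n \<omega> - \<mu>) - \<eta> \<omega>) \<le> cmod (\<alpha> n) * gamma_q M Fp p (n - j) y"
      by blast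
  qed (use p Mq_nonneg[OF p1(1)] gamma_nonneg[OF p] sum_gamma_le[OF p] in auto)
  also have "\<dots> \<le> 16 * ((p - 1) * ?m * ?G) * (\<Sum>n<N. (cmod (\<alpha> n))\<^sup>2)"
  proof -
    have "0 \<le> (p - 1) * ?m * ?G * (\<Sum>n<N. (cmod (\<alpha> n))\<^sup>2)"
      using p Mq_nonneg[OF p1(1)] Gamma_nonneg[OF p] by (simp add: sum_nonneg)
    then show ?thesis by (simp add: algebra_simps)
  qed
  also have "\<dots> = (4 * sqrt ((p - 1) * ?m * ?G) * sqrt (\<Sum>n<N. (cmod (\<alpha> n))\<^sup>2))\<^sup>2"
    using p Mq_nonneg[OF p1(1)] Gamma_nonneg[OF p] by (simp add: power_mult_distrib sum_nonneg)
  finally show ?thesis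
    by (rule power2_le_imp_le) (use p Mq_nonneg[OF p1(1)] Gamma_nonneg[OF p] in \<open>simp add: sum_nonneg\<close>)
qed

end

section \<open>Overlapping windows\<close>

text \<open>A window that covers \<open>n\<close> starts at most \<open>L - 1\<close> before
  \<open>n\<close>, so its index lies between \<open>n div K - (L - 1) div K\<close> and
  \<open>n div K\<close>.\<close>

lemma card_windows_le:
  fixes K L n :: nat
  assumes "1 \<le> K"
  shows "card {i\<in>{..<k}. i * K \<le> n \<and> n < i * K + L} \<le> (L - 1) div K + 1"
proof -
  let ?q = "(L - 1) div K"
  have "{i\<in>{..<k}. i * K \<le> n \<and> n < i * K + L} \<subseteq> {n div K - ?q..n div K}"
  proof clarify
    fix i assume i: "i * K \<le> n" "n < i * K + L"
    have "i \<le> n div K" using i assms by (simp add: less_eq_div_iff_mult_less_eq)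
    moreover have "n div K \<le> i + ?q"
    proof -
      have "n div K \<le> (L - 1 + i * K) div K" using i by (intro div_le_mono) auto
      then show ?thesis using assms by simp
    qed
    ultimately show "i \<in> {n div K - ?q..n div K}" by auto
  qed
  from card_mono[OF _ this] show ?thesis by simp
qed

text \<open>Double counting: the time \<open>n\<close> contributes once for every window that covers
  it. The range up to \<open>k * K + L\<close> contains all windows with index below
  \<open>k\<close>.\<close>

lemma sum_windows:
  fixes f :: "nat \<Rightarrow> 'b::real_vector"
  shows "(\<Sum>i<k. \<Sum>m<L. f (i * K + m))
    = (\<Sum>n<k * K + L. real (card {i\<in>{..<k}. i * K \<le> n \<and> n < i * K + L}) *\<^sub>R f n)"
proof -
  have "(\<Sum>m<L. f (i * K + m)) = (\<Sum>n\<in>{n\<in>{..<k * K + L}. i * K \<le> n \<and> n < i * K + L}. f n)" if "i < k" for i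
  proof (rule sum.reindex_bij_witness[of _ "\<lambda>n. n - i * K" "\<lambda>m. i * K + m"])
    fix m assume "m \<in> {..<L}"
    moreover have "i * K \<le> k * K" using that by simp
    ultimately show "i * K + m \<in> {n\<in>{..<k * K + L}. i * K \<le> n \<and> n < i * K + L}"
      by (simp only: mem_Collect_eq lessThan_iff) linarith
  qed auto
  then have "(\<Sum>i<k. \<Sum>m<L. f (i * K + m)) = (\<Sum>i<k. \<Sum>n\<in>{n\<in>{..<k * K + L}. i * K \<le> n \<and> n < i * K + L}. f n)"
    by (rule sum.cong[OF refl]) simp
  also have "\<dots> = (\<Sum>n<k * K + L. \<Sum>i\<in>{i\<in>{..<k}. i * K \<le> n \<and> n < i * K + L}. f n)"
    by (rule sum.swap_restrict) auto
  finally show ?thesis by (simp add: sum_constant_scaleR)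
qed

section \<open>Rank one matrices\<close>

text \<open>The sesquilinear form behind \<open>outer\<close>, which names the cross terms.\<close>

definition outer2 :: "complex ^ 'n \<Rightarrow> complex ^ 'n \<Rightarrow> complex ^ 'n ^ 'n" where
  "outer2 u v = (\<chi> i j. u $ i * cnj (v $ j))"

lemma outer_eq_outer2: "outer u = outer2 u u"
  by (simp add: outer_def outer2_def)

lemma norm_outer2: "norm (outer2 u v) = norm u * norm v"
  by (simp add: norm_vec_def outer2_def norm_mult flip: L2_set_left_distrib L2_set_right_distrib)

lemma outer_diff_eq: "outer u - outer v = outer2 u (u - v) + outer2 (u - v) v"
  by (simp add: outer_def outer2_def vec_eq_iff algebra_simps)

lemma outer_of_diff: "outer (u - v) = outer u - outer2 u v - outer2 v u + outer v"
  by (simp add: outer_def outer2_def vec_eq_iff algebra_simps)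

lemma outer2_sum_left: "outer2 (c *\<^sub>R (\<Sum>i\<in>I. u i)) v = c *\<^sub>R (\<Sum>i\<in>I. outer2 (u i) v)"
  by (simp add: outer2_def vec_eq_iff sum_component sum_distrib_right)

lemma outer2_sum_right: "outer2 v (c *\<^sub>R (\<Sum>i\<in>I. u i)) = c *\<^sub>R (\<Sum>i\<in>I. outer2 v (u i))"
  by (simp add: outer2_def vec_eq_iff sum_component sum_distrib_left)

lemma measurable_outer2 [measurable (raw)]:
  assumes "f \<in> borel_measurable A" "g \<in> borel_measurable A"
  shows "(\<lambda>\<omega>. outer2 (f \<omega>) (g \<omega>)) \<in> borel_measurable A"
proof (rule borel_measurable_continuous_Pair[OF assms])
  show "continuous_on UNIV (\<lambda>x. outer2 (fst x) (snd x) :: complex ^ 'b ^ 'b)"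
    unfolding outer2_def by (intro continuous_intros)
qed

lemma measurable_outer [measurable (raw)]:
  "f \<in> borel_measurable A \<Longrightarrow> (\<lambda>\<omega>. outer (f \<omega>)) \<in> borel_measurable A"
  unfolding outer_eq_outer2 by (rule measurable_outer2)

lemma Lp_outer2:
  assumes "1 \<le> r" "Lp P (2 * r) U" "Lp P (2 * r) V"
  shows "Lp P r (\<lambda>\<omega>. outer2 (U \<omega>) (V \<omega>))"
    and "Lq_norm P r (\<lambda>\<omega>. outer2 (U \<omega>) (V \<omega>)) \<le> Lq_norm P (2 * r) U * Lq_norm P (2 * r) V"
  using Lq_norm_mult[OF assms measurable_outer2[OF Lp_measurable[OF assms(2)] Lp_measurable[OF assms(3)]]]
  by (auto simp: norm_outer2)

section \<open>The batch estimator\<close>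

lemma scale_cvec_diff: "c *s cvec u - c *s cvec v = c *s cvec (u - v)"
  by (simp add: cvec_def vec_eq_iff algebra_simps)

lemma scaleR_scale_cvec: "a *\<^sub>R (c *s v) = (complex_of_real a * c) *s v"
  by (simp add: vec_eq_iff scaleR_conv_of_real[where 'a=complex] mult.assoc)

text \<open>Padding with zeros turns a sum over a window into one that starts at time
  \<open>0\<close>, the form in which weighted sums of the process are estimated.\<close>

lemma sum_shift_window:
  fixes f :: "nat \<Rightarrow> nat \<Rightarrow> 'b::comm_monoid_add"
  shows "(\<Sum>m<L. f (a + m) m) = (\<Sum>n<a + L. if a \<le> n then f n (n - a) else 0)"
proof (induction L)
  case 0
  show ?case by (auto intro!: sum.neutral[symmetric])
qed simp

text \<open>\<open>L\<close> is the window length, as \<open>M\<close> already denotes the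
  probability space. The constants are taken at \<open>2 * q\<close>, so moments of \<open>y\<close>
  occur at exponent \<open>2 * (2 * q)\<close>.\<close>

locale batch_estimator = L_mixing_process M F Fp y
  for M :: "'a measure" and F Fp and y :: "nat \<Rightarrow> 'a \<Rightarrow> real ^ 'n" +
  fixes K L :: nat and w :: "real \<Rightarrow> nat \<Rightarrow> complex" and s q :: real
  assumes stationary: "stationary M y" and K: "1 \<le> K" "K \<le> L"
    and weights: "(\<Sum>j<L. (cmod (w s j))\<^sup>2) = 1" and q: "1 \<le> q"
begin

abbreviation "\<mu> \<equiv> \<integral>\<omega>. y 0 \<omega> \<partial>M"
abbreviation "C1 \<equiv> c1 M Fp y (2 * q)"
abbreviation "C2 \<equiv> c2 M Fp K L y (2 * q)"
abbreviation "CC \<equiv> cc M Fp K L y (2 * q)"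
abbreviation "\<Gamma> \<equiv> Gamma_dq M Fp (2 * (2 * q)) y"
abbreviation "B \<equiv> (L - 1) div K + 1"

section \<open>Windowed transforms, their centred matrices and approximants\<close>

definition "z i \<omega> = (\<Sum>m<L. w s m *s cvec (y (i * K + m) \<omega> - \<mu>))"

text \<open>The approximant of \<open>z i\<close>; here \<open>j\<close> is a time and not a window
  index.\<close>

definition "zh i j \<omega> = (\<Sum>m<L. w s m *s cvec (cond_exp_vec M (Fp j) (y (i * K + m)) \<omega> - \<mu>))"

text \<open>Bounds the error of approximating a window given the future of the window
  \<open>\<tau>\<close> steps earlier. That future is taken at its last sample, hence the shift by
  \<open>L - 1\<close>; the guard excludes truncated subtraction.\<close>

definition "\<delta> \<tau> = (\<Sum>m<L. if L - 1 \<le> \<tau> * K + m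
  then gamma_q M Fp (2 * (2 * q)) (\<tau> * K + m - (L - 1)) y else 0)"

lemma p2: "2 \<le> 2 * (2 * q)" "1 \<le> 2 * (2 * q)" "0 < 2 * (2 * q)" "2 \<le> 2 * q" "1 \<le> 2 * q"
  using q by auto

lemma C1_nonneg: "0 \<le> C1"
  using Mq_nonneg[OF p2(2)] Gamma_nonneg[OF p2(1)] q by (simp add: c1_def)

lemma C2_nonneg: "0 \<le> C2"
  using C1_nonneg Gamma_nonneg[OF p2(1)] by (simp add: c2_def)

lemma CC_nonneg: "0 \<le> CC"
  using C1_nonneg by (simp add: cc_def)

lemma mean_y: "(\<integral>\<omega>. y n \<omega> \<partial>M) = \<mu>"
  using integral_stationary_shift[OF stationary y_measurable, of "\<lambda>f. f 0" n] by simp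

lemma Lq_norm_weighted_sum_le_C1:
  "Lq_norm M (2 * (2 * q)) (\<lambda>\<omega>. \<Sum>n<N. \<alpha> n *s cvec (y n \<omega> - \<mu>)) \<le> C1 * sqrt (\<Sum>n<N. (cmod (\<alpha> n))\<^sup>2)"
  using Lq_norm_weighted_sum_le[OF p2(1) mean_y] by (simp add: c1_def)

lemma Lp_z: "Lp M (2 * (2 * q)) (z i)"
  using Lq_norm_sum[OF p2(2), of "{..<L}" M "\<lambda>m \<omega>. w s m *s cvec (y (i * K + m) \<omega> - \<mu>)"]
    Lp_centered_cvec[OF p2(2)]
  by (simp add: z_def[abs_def])

text \<open>The window is a weighted sum padded with zeros, and its weights have unit square
  sum.\<close>

lemma Lq_norm_z_le: "Lq_norm M (2 * (2 * q)) (z i) \<le> C1"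
proof -
  define \<alpha> where "\<alpha> n = (if i * K \<le> n then w s (n - i * K) else 0)" for n
  have "z i = (\<lambda>\<omega>. \<Sum>n<i * K + L. \<alpha> n *s cvec (y n \<omega> - \<mu>))"
  proof
    fix \<omega>
    have "(\<Sum>n<i * K + L. \<alpha> n *s cvec (y n \<omega> - \<mu>))
        = (\<Sum>n<i * K + L. if i * K \<le> n then w s (n - i * K) *s cvec (y n \<omega> - \<mu>) else 0)"
      by (intro sum.cong refl) (simp add: \<alpha>_def)
    then show "z i \<omega> = (\<Sum>n<i * K + L. \<alpha> n *s cvec (y n \<omega> - \<mu>))"
      using sum_shift_window[of "\<lambda>n m. w s m *s cvec (y n \<omega> - \<mu>)" "i * K" L] by (simp add: z_def)
  qed
  moreover have "(\<Sum>n<i * K + L. (cmod (\<alpha> n))\<^sup>2) = 1"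
  proof -
    have "(\<Sum>n<i * K + L. (cmod (\<alpha> n))\<^sup>2) = (\<Sum>n<i * K + L. if i * K \<le> n then (cmod (w s (n - i * K)))\<^sup>2 else 0)"
      by (intro sum.cong refl) (simp add: \<alpha>_def)
    then show ?thesis
      using sum_shift_window[of "\<lambda>n m. (cmod (w s m))\<^sup>2" "i * K" L] weights by simp
  qed
  ultimately show ?thesis using Lq_norm_weighted_sum_le_C1[where \<alpha> = \<alpha> and N = "i * K + L"] by simp
qed

lemma integral_outer_z: "(\<integral>\<omega>. outer (z i \<omega>) \<partial>M) = (\<integral>\<omega>. outer (z 0 \<omega>) \<partial>M)"
proof -
  let ?\<Phi> = "\<lambda>f. outer (\<Sum>m<L. w s m *s cvec (f m - \<mu>))"
  have "?\<Phi> \<in> borel_measurable (PiM UNIV (\<lambda>_. borel))" by measurable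
  from integral_stationary_shift[OF stationary y_measurable this, of "i * K"]
  show ?thesis by (simp add: z_def add.commute)
qed

text \<open>Subtracting the mean at index \<open>0\<close> centres every \<open>Z i\<close>, by
  \<open>integral_outer_z\<close>.\<close>

definition "Z i \<omega> = outer (z i \<omega>) - (\<integral>\<omega>. outer (z 0 \<omega>) \<partial>M)"

lemma Lp_Z: "Lp M (2 * q) (Z i)" and Lq_norm_Z_le: "Lq_norm M (2 * q) (Z i) \<le> 2 * C1\<^sup>2"
proof -
  have o: "Lp M (2 * q) (\<lambda>\<omega>. outer (z i \<omega>))" "Lq_norm M (2 * q) (\<lambda>\<omega>. outer (z i \<omega>)) \<le> C1\<^sup>2" for i
    using Lp_outer2[OF p2(5) Lp_z[of i] Lp_z[of i]]
      mult_mono[OF Lq_norm_z_le[of i] Lq_norm_z_le[of i] C1_nonneg Lq_norm_nonneg]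
    by (auto simp: outer_eq_outer2 power2_eq_square)
  have m: "norm (\<integral>\<omega>. outer (z 0 \<omega>) \<partial>M) \<le> C1\<^sup>2"
    using Lp_imp_integrable(2)[OF p2(4) o(1)] o(2) by (rule order_trans)
  have p: "0 < 2 * q" using q by simp
  note d = Lq_norm_diff[OF p2(5) o(1)[of i] Lp_const(1)[OF p, of "\<integral>\<omega>. outer (z 0 \<omega>) \<partial>M"]]
  show "Lp M (2 * q) (Z i)" unfolding Z_def[abs_def] by (rule d)
  show "Lq_norm M (2 * q) (Z i) \<le> 2 * C1\<^sup>2"
    using d(2) o(2)[of i] m unfolding Z_def[abs_def] Lp_const(2)[OF p] by linarith
qed

lemma weight_le_1: "m < L \<Longrightarrow> cmod (w s m) \<le> 1"
proof -
  assume "m < L"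
  then have "(cmod (w s m))\<^sup>2 \<le> 1\<^sup>2"
    using member_le_sum[of m "{..<L}" "\<lambda>j. (cmod (w s j))\<^sup>2"] weights by simp
  then show ?thesis by (rule power2_le_imp_le) simp
qed

text \<open>At lag \<open>B\<close> or more, window \<open>i\<close> starts no earlier than the last
  sample of window \<open>j\<close>, so each of its samples has a conditional expectation error
  bounded by \<open>gamma_q\<close>; the weights have modulus at most \<open>1\<close>.\<close>

lemma Lq_norm_z_diff_zh_le:
  assumes "j \<le> i" "B \<le> i - j"
  shows "Lp M (2 * (2 * q)) (\<lambda>\<omega>. z i \<omega> - zh i (j * K + (L - 1)) \<omega>)"
    and "Lq_norm M (2 * (2 * q)) (\<lambda>\<omega>. z i \<omega> - zh i (j * K + (L - 1)) \<omega>) \<le> \<delta> (i - j)"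
proof -
  let ?p = "2 * (2 * q)" and ?j = "j * K + (L - 1)"
  let ?d = "\<lambda>m \<omega>. y (i * K + m) \<omega> - cond_exp_vec M (Fp ?j) (y (i * K + m)) \<omega>"
  have lag: "L - 1 \<le> (i - j) * K"
  proof -
    have "L - 1 < B * K" using K dividend_less_times_div[of K "L - 1"] by (simp add: mult.commute)
    also have "\<dots> \<le> (i - j) * K" using assms by (intro mult_right_mono) auto
    finally show ?thesis by simp
  qed
  have idx: "?j \<le> i * K + m" "i * K + m - ?j = (i - j) * K + m - (L - 1)" "L - 1 \<le> (i - j) * K + m" for m
  proof -
    have "i * K = j * K + (i - j) * K" using assms by (simp add: add_mult_distrib[symmetric])
    then show "?j \<le> i * K + m" "i * K + m - ?j = (i - j) * K + m - (L - 1)" "L - 1 \<le> (i - j) * K + m"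
      using lag by auto
  qed
  have d: "Lp M ?p (?d m)" for m
    by (rule Lq_norm_diff(1)[OF p2(2) Lp_y[OF p2(2)] Lp_cond_exp_vec(1)[OF subalgebra_F(2) p2(1) Lp_y[OF p2(2)]]])
  have t: "Lp M ?p (\<lambda>\<omega>. w s m *s cvec (?d m \<omega>))"
    "Lq_norm M ?p (\<lambda>\<omega>. w s m *s cvec (?d m \<omega>)) \<le> cmod (w s m) * Lq_norm M ?p (?d m)" for m
    using Lp_mono[OF p2(3) d[of m] measurable_scale_cvec[OF Lp_measurable[OF d[of m]]], of "w s m" "cmod (w s m)"]
    by (auto simp: norm_scale_cvec)
  have eq: "(\<lambda>\<omega>. z i \<omega> - zh i ?j \<omega>) = (\<lambda>\<omega>. \<Sum>m<L. w s m *s cvec (?d m \<omega>))"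
    unfolding z_def zh_def sum_subtractf[symmetric] scale_cvec_diff by simp
  have sm: "Lp M ?p (\<lambda>\<omega>. \<Sum>m<L. w s m *s cvec (?d m \<omega>))"
    "Lq_norm M ?p (\<lambda>\<omega>. \<Sum>m<L. w s m *s cvec (?d m \<omega>)) \<le> (\<Sum>m<L. Lq_norm M ?p (\<lambda>\<omega>. w s m *s cvec (?d m \<omega>)))"
    by (rule Lq_norm_sum[OF p2(2) t(1), THEN conjunct1] Lq_norm_sum[OF p2(2) t(1), THEN conjunct2])+
  show "Lp M ?p (\<lambda>\<omega>. z i \<omega> - zh i ?j \<omega>)" unfolding eq by (rule sm)
  have "(\<Sum>m<L. Lq_norm M ?p (\<lambda>\<omega>. w s m *s cvec (?d m \<omega>))) \<le> \<delta> (i - j)"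
    unfolding \<delta>_def
  proof (rule sum_mono)
    fix m assume "m \<in> {..<L}"
    have "Lq_norm M ?p (\<lambda>\<omega>. w s m *s cvec (?d m \<omega>)) \<le> cmod (w s m) * Lq_norm M ?p (?d m)" by (rule t)
    also have "\<dots> \<le> 1 * gamma_q M Fp ?p (i * K + m - ?j) y"
      using weight_le_1[of m] \<open>m \<in> {..<L}\<close> by (intro mult_mono Lq_norm_cond_exp_le_gamma p2 idx) auto
    finally show "Lq_norm M ?p (\<lambda>\<omega>. w s m *s cvec (?d m \<omega>))
        \<le> (if L - 1 \<le> (i - j) * K + m then gamma_q M Fp ?p ((i - j) * K + m - (L - 1)) y else 0)"
      using idx by simp
  qed
  with sm(2) show "Lq_norm M ?p (\<lambda>\<omega>. z i \<omega> - zh i ?j \<omega>) \<le> \<delta> (i - j)" unfolding eq by linarith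
qed

lemma delta_nonneg: "0 \<le> \<delta> \<tau>"
  unfolding \<delta>_def by (intro sum_nonneg) (simp only: gamma_nonneg[OF p2(1)] order_refl simp_thms split: if_split)

text \<open>The double sum runs over windows of length \<open>L\<close> placed \<open>K\<close>
  apart, so each value of \<open>gamma_q\<close> is counted at most \<open>B\<close> times.\<close>

lemma sum_delta_le: "(\<Sum>\<tau><N. \<delta> \<tau>) \<le> real B * \<Gamma>"
proof -
  define f where "f n = (if L - 1 \<le> n then gamma_q M Fp (2 * (2 * q)) (n - (L - 1)) y else 0)" for n
  have f: "0 \<le> f n" for n unfolding f_def by (simp only: gamma_nonneg[OF p2(1)] order_refl simp_thms split: if_split)
  have "(\<Sum>\<tau><N. \<delta> \<tau>) = (\<Sum>n<N * K + L. real (card {i\<in>{..<N}. i * K \<le> n \<and> n < i * K + L}) *\<^sub>R f n)"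
    unfolding \<delta>_def sum_windows[symmetric] f_def ..
  also have "\<dots> \<le> (\<Sum>n<N * K + L. real B * f n)"
    using card_windows_le[OF K(1), of N _ L] f
    by (intro sum_mono) (simp only: real_scaleR_def, intro mult_right_mono of_nat_mono; simp)
  also have "\<dots> = real B * (\<Sum>n<N * K + L. f n)" by (simp only: sum_distrib_left)
  also have "(\<Sum>n<N * K + L. f n) = (\<Sum>m<N * K + 1. gamma_q M Fp (2 * (2 * q)) m y)"
  proof -
    have "N * K + L = (L - 1) + (N * K + 1)" using K by simp
    then show ?thesis
      unfolding f_def using sum_shift_window[of "\<lambda>n m. gamma_q M Fp (2 * (2 * q)) m y" "L - 1" "N * K + 1"]
      by (simp only:)
  qed
  also have "real B * \<dots> \<le> real B * \<Gamma>"
    by (intro mult_left_mono sum_gamma_le p2) simp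
  finally show ?thesis .
qed

text \<open>At lags below \<open>B\<close> the windows overlap and the approximant is
  \<open>0\<close>, at the cost of the norm bound of \<open>Z i\<close>.\<close>

definition "g \<tau> = (if \<tau> < B then 2 * C1\<^sup>2 else 5 * C1 * \<delta> \<tau>)"

lemma g_nonneg: "0 \<le> g \<tau>"
  using C1_nonneg delta_nonneg by (simp add: g_def)

text \<open>\<open>C2\<close> is \<open>2 * B * C1 + B * \<Gamma>\<close>: its second part matches
  the bound on the sum of \<open>\<delta>\<close>, and its first part exceeds what the
  \<open>B\<close> initial lags need.\<close>

lemma sum_g_le: "(\<Sum>\<tau><N. g \<tau>) \<le> 5 * C1 * C2"
proof -
  have "(\<Sum>\<tau><N. g \<tau>) \<le> (\<Sum>\<tau><N. (if \<tau> < B then 2 * C1\<^sup>2 else 0) + 5 * C1 * \<delta> \<tau>)"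
    using C1_nonneg delta_nonneg by (intro sum_mono) (simp add: g_def)
  also have "\<dots> = (\<Sum>\<tau><N. if \<tau> < B then 2 * C1\<^sup>2 else 0) + 5 * C1 * (\<Sum>\<tau><N. \<delta> \<tau>)"
    by (simp only: sum.distrib sum_distrib_left)
  also have "(\<Sum>\<tau><N. if \<tau> < B then 2 * C1\<^sup>2 else 0) \<le> real B * (2 * C1\<^sup>2)"
  proof -
    have "(\<Sum>\<tau><N. if \<tau> < B then 2 * C1\<^sup>2 else 0) = (\<Sum>\<tau>\<in>{..<N} \<inter> {\<tau>. \<tau> < B}. 2 * C1\<^sup>2)"
      by (simp only: sum.inter_restrict[OF finite_lessThan] mem_Collect_eq)
    also have "\<dots> \<le> (\<Sum>\<tau><B. 2 * C1\<^sup>2)" by (intro sum_mono2) auto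
    finally show ?thesis by simp
  qed
  also have "5 * C1 * (\<Sum>\<tau><N. \<delta> \<tau>) \<le> 5 * C1 * (real B * \<Gamma>)"
    using C1_nonneg sum_delta_le by (intro mult_left_mono) auto
  also have "real B * (2 * C1\<^sup>2) + 5 * C1 * (real B * \<Gamma>) \<le> 5 * C1 * C2"
  proof -
    have "5 * C1 * C2 = real B * (10 * C1\<^sup>2) + 5 * C1 * (real B * \<Gamma>)"
      by (simp add: c2_def power2_eq_square algebra_simps)
    moreover have "real B * (2 * C1\<^sup>2) \<le> real B * (10 * C1\<^sup>2)" by (intro mult_left_mono) auto
    ultimately show ?thesis by linarith
  qed
  finally show ?thesis by simp
qed

text \<open>
  Where \<open>\<delta>\<close> is at least \<open>2/5 * C1\<close>, the approximant \<open>0\<close> is good enough. Otherwise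
  \<open>\<parallel>zh\<parallel> \<le> C1 + \<delta> \<le> 7/5 * C1\<close>, which makes a contraction property of the conditional expectation
  of complex vectors unnecessary. The factor 5 in \<open>g\<close> serves both cases.
\<close>

lemma Z_approx:
  assumes "j \<le> i"
  shows "\<exists>\<eta>. \<eta> \<in> borel_measurable (Fp (j * K + (L - 1))) \<and> Lp M (2 * q) \<eta> \<and> (\<integral>\<omega>. \<eta> \<omega> \<partial>M) = 0
    \<and> Lq_norm M (2 * q) (\<lambda>\<omega>. Z i \<omega> - \<eta> \<omega>) \<le> 1 * g (i - j)"
proof (cases "2 * C1\<^sup>2 \<le> g (i - j)")
  case True
  then show ?thesis
    using Lp_zero(1)[of "2 * q" M] Lq_norm_Z_le[of i] q by (intro exI[of _ "\<lambda>_. 0"]) auto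
next
  case False
  then have "B \<le> i - j" and g: "g (i - j) = 5 * C1 * \<delta> (i - j)" by (auto simp: g_def split: if_splits)
  note zd = Lq_norm_z_diff_zh_le[OF assms this(1)]
  define d zt where "d = \<delta> (i - j)" and "zt = zh i (j * K + (L - 1))"
  have "5 * C1 * d < 2 * C1\<^sup>2" using False g by (simp add: d_def)
  then have "C1 * (5 * d) < C1 * (2 * C1)" by (simp add: power2_eq_square ac_simps)
  then have d: "5 * d < 2 * C1" using C1_nonneg by (simp add: mult_less_cancel_left)
  have d0: "0 \<le> d" by (simp add: d_def delta_nonneg)
  have D: "Lp M (2 * (2 * q)) (\<lambda>\<omega>. z i \<omega> - zt \<omega>)" "Lq_norm M (2 * (2 * q)) (\<lambda>\<omega>. z i \<omega> - zt \<omega>) \<le> d"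
    using zd by (auto simp: d_def zt_def)
  have zt: "Lp M (2 * (2 * q)) zt" "Lq_norm M (2 * (2 * q)) zt \<le> C1 + d"
    using Lq_norm_diff[OF p2(2) Lp_z[of i] D(1)] D(2) Lq_norm_z_le[of i] by auto
  note o1 = Lp_outer2[OF p2(5) Lp_z[of i] D(1)] and o2 = Lp_outer2[OF p2(5) D(1) zt(1)]
  let ?e = "\<lambda>\<omega>. outer (z i \<omega>) - outer (zt \<omega>)"
  have e: "Lp M (2 * q) ?e" "Lq_norm M (2 * q) ?e \<le> (12/5) * C1 * d"
  proof -
    show "Lp M (2 * q) ?e" unfolding outer_diff_eq by (rule Lq_norm_triangle(1)[OF p2(5) o1(1) o2(1)])
    have "Lq_norm M (2 * q) ?e \<le> C1 * d + d * (C1 + d)"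
      unfolding outer_diff_eq
      using Lq_norm_triangle(2)[OF p2(5) o1(1) o2(1)] o1(2) o2(2)
        mult_mono[OF Lq_norm_z_le[of i] D(2) C1_nonneg Lq_norm_nonneg]
        mult_mono[OF D(2) zt(2) d0 Lq_norm_nonneg] by linarith
    \<comment> \<open>The smallness of \<open>d\<close> gives
      \<open>d * d \<le> (2/5) * C1 * d\<close>, which is added to
      \<open>2 * C1 * d\<close>.\<close>
    also have "\<dots> \<le> (12/5) * C1 * d"
      using mult_left_mono[of "5 * d" "2 * C1" d] d d0 by (simp add: algebra_simps)
    finally show "Lq_norm M (2 * q) ?e \<le> (12/5) * C1 * d" .
  qed
  have oz: "Lp M (2 * q) (\<lambda>\<omega>. outer (z i \<omega>))" "Lp M (2 * q) (\<lambda>\<omega>. outer (zt \<omega>))"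
    unfolding outer_eq_outer2 by (rule Lp_outer2(1)[OF p2(5)]; rule Lp_z zt)+
  note iz = Lp_imp_integrable(1)[OF p2(4) oz(1)] and izt = Lp_imp_integrable(1)[OF p2(4) oz(2)]
  have q0: "0 < 2 * q" using q by simp
  let ?m = "\<integral>\<omega>. outer (zt \<omega>) \<partial>M"
  let ?\<eta> = "\<lambda>\<omega>. outer (zt \<omega>) - ?m"
  have eta: "Lp M (2 * q) ?\<eta>" by (rule Lq_norm_diff(1)[OF p2(5) oz(2) Lp_const(1)[OF q0]])
  have "(\<integral>\<omega>. ?\<eta> \<omega> \<partial>M) = 0" using izt by (simp add: prob_space)
  moreover have "?\<eta> \<in> borel_measurable (Fp (j * K + (L - 1)))"
  proof -
    have [measurable]: "cond_exp_vec M (Fp k) x \<in> borel_measurable (Fp k)" for k and x :: "'a \<Rightarrow> real ^ 'n"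
      by (rule cond_exp_vec_measurable)
    show ?thesis unfolding zt_def zh_def by measurable
  qed
  moreover have "Lq_norm M (2 * q) (\<lambda>\<omega>. Z i \<omega> - ?\<eta> \<omega>) \<le> 1 * g (i - j)"
  proof -
    \<comment> \<open>The centred error is \<open>?e\<close> minus its mean, which at most doubles
      the norm bound; \<open>24/5 \<le> 5\<close> explains the factor \<open>5\<close> in
      \<open>g\<close>.\<close>
    have "(\<lambda>\<omega>. Z i \<omega> - ?\<eta> \<omega>) = (\<lambda>\<omega>. ?e \<omega> - (\<integral>\<omega>. ?e \<omega> \<partial>M))"
      using iz izt by (simp add: Z_def integral_outer_z[of i] fun_eq_iff)
    then have "Lq_norm M (2 * q) (\<lambda>\<omega>. Z i \<omega> - ?\<eta> \<omega>)
        \<le> Lq_norm M (2 * q) ?e + norm (\<integral>\<omega>. ?e \<omega> \<partial>M)"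
      using Lq_norm_diff(2)[OF p2(5) e(1) Lp_const(1)[OF q0], of "\<integral>\<omega>. ?e \<omega> \<partial>M"]
      unfolding Lp_const(2)[OF q0] by simp
    also have "\<dots> \<le> 2 * ((12/5) * C1 * d)"
      using Lp_imp_integrable(2)[OF p2(4) e(1)] e(2) by linarith
    also have "\<dots> \<le> 5 * C1 * d" using C1_nonneg d0 by simp
    finally show ?thesis by (simp add: g d_def)
  qed
  ultimately show ?thesis using eta by blast
qed

text \<open>The mixing inequality with \<open>a = 1\<close>, \<open>m = 2 * C1\<^sup>2\<close> and
  \<open>G = 5 * C1 * C2\<close> yields the constant \<open>60\<close>, which the claimed
  \<open>16 * 6 = 96\<close> covers.\<close>

lemma Lq_norm_sum_Z_le:
  "Lq_norm M (2 * q) (\<lambda>\<omega>. \<Sum>i<k. Z i \<omega>) \<le> 4 * sqrt (6 * (2 * q - 1) * C1 ^ 3 * C2) * sqrt (real k)"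
proof -
  \<comment> \<open>Sampling at the last time of each window makes \<open>Z i\<close> measurable
    with respect to \<open>?F i\<close>, and a subsampled filtration pair is again one.\<close>
  let ?F = "\<lambda>i. F (i * K + (L - 1))" and ?Fp = "\<lambda>i. Fp (i * K + (L - 1))"
  have FP: "filtration_pair M ?F ?Fp"
    using filtration unfolding filtration_pair_def by (auto simp: mult_le_mono1)
  have nn: "0 \<le> (2 * q - 1) * C1 ^ 3 * C2" using q C1_nonneg C2_nonneg by simp
  then have nn6: "0 \<le> 6 * (2 * q - 1) * C1 ^ 3 * C2"
    using mult_nonneg_nonneg[OF zero_le_numeral nn] by (simp only: mult.assoc)
  have "(Lq_norm M (2 * q) (\<lambda>\<omega>. \<Sum>i<k. Z i \<omega>))\<^sup>2
      \<le> 6 * (2 * q - 1) * (2 * C1\<^sup>2) * (5 * C1 * C2) * (\<Sum>i<k. 1\<^sup>2)"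
  proof (rule Lq_norm_square_mixing_sum_le[OF p2(4) FP _ _ _ _ _ Z_approx])
    fix i
    have [measurable]: "y (i * K + m) \<in> borel_measurable (?F i)" if "m < L" for m
      using that by (intro measurable_F_mono[OF y_measurable_F]) auto
    have "z i \<in> borel_measurable (?F i)"
      unfolding z_def[abs_def] by (intro borel_measurable_sum) measurable
    then show "Z i \<in> borel_measurable (?F i)"
      unfolding Z_def[abs_def] by measurable
  qed (use Lp_Z Lq_norm_Z_le g_nonneg sum_g_le C1_nonneg in auto)
  also have "\<dots> = 60 * ((2 * q - 1) * C1 ^ 3 * C2) * real k"
    by (simp add: power2_eq_square power3_eq_cube)
  also have "\<dots> \<le> 96 * ((2 * q - 1) * C1 ^ 3 * C2) * real k"
    using nn by (intro mult_right_mono) auto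
  also have "\<dots> = (4 * sqrt (6 * (2 * q - 1) * C1 ^ 3 * C2) * sqrt (real k))\<^sup>2"
    using real_sqrt_pow2[OF nn6] by (simp add: power_mult_distrib del: real_sqrt_pow2_iff)
  finally show ?thesis
    by (rule power2_le_imp_le) (rule mult_nonneg_nonneg[OF mult_nonneg_nonneg[OF zero_le_numeral real_sqrt_ge_zero[OF nn6]] real_sqrt_ge_zero[OF of_nat_0_le_iff]])
qed

section \<open>The error of the mean estimate\<close>

definition "hv k \<omega> = hfun L w s *s cvec (muhat K L y k \<omega> - \<mu>)"

lemma hv_eq:
  assumes "1 \<le> k"
  shows "hv k \<omega> = (\<Sum>n<k * K + L. (real (card {i\<in>{..<k}. i * K \<le> n \<and> n < i * K + L})
    * (hfun L w s / (real k * real L))) *s cvec (y n \<omega> - \<mu>))"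
proof -
  let ?T = "\<lambda>v. hfun L w s *s cvec v"
  let ?c = "hfun L w s / (of_nat k * of_nat L)"
  note lin = bounded_linear.linear[OF bounded_linear_cvec[of "hfun L w s"]]
  have L: "0 < L" using K by simp
  have "muhat K L y k \<omega> - \<mu> = (1 / (real k * real L)) *\<^sub>R (\<Sum>i<k. \<Sum>m<L. y (i * K + m) \<omega> - \<mu>)"
    using assms L
    by (simp add: muhat_def ybar_def sum_subtractf scaleR_right_diff_distrib sum_constant_scaleR scaleR_sum_right del: sum_constant)
  then have "hv k \<omega> = (1 / (real k * real L)) *\<^sub>R (\<Sum>i<k. \<Sum>m<L. ?T (y (i * K + m) \<omega> - \<mu>))"
    unfolding hv_def by (simp only: linear_cmul[OF lin] linear_sum[OF lin])
  also have "\<dots> = (1 / (real k * real L)) *\<^sub>R (\<Sum>n<k * K + L. real (card {i\<in>{..<k}. i * K \<le> n \<and> n < i * K + L}) *\<^sub>R ?T (y n \<omega> - \<mu>))"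
    by (simp only: sum_windows[of "\<lambda>n. ?T (y n \<omega> - \<mu>)"])
  finally show ?thesis
    by (simp add: scaleR_sum_right scaleR_scale_cvec mult.assoc)
qed

text \<open>The squared coefficients sum to at most \<open>B / k\<close>: the coverage counts are at
  most \<open>B\<close> and have total \<open>k * L\<close>, and Cauchy--Schwarz with unit weights
  gives \<open>(cmod (hfun L w s))\<^sup>2 \<le> L\<close>. Relaxing \<open>B\<close> to
  \<open>B\<^sup>2\<close> produces \<open>CC\<close>.\<close>

lemma Lq_norm_hv_le:
  assumes k: "1 \<le> k"
  shows "Lp M (2 * (2 * q)) (hv k)" "Lq_norm M (2 * (2 * q)) (hv k) \<le> CC / sqrt (real k)"
proof -
  define N c where "N n = real (card {i\<in>{..<k}. i * K \<le> n \<and> n < i * K + L})"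
    and "c = hfun L w s / (real k * real L)" for n
  have L: "0 < L" using K by simp
  have eq: "hv k = (\<lambda>\<omega>. \<Sum>n<k * K + L. (N n * c) *s cvec (y n \<omega> - \<mu>))"
    using hv_eq[OF k] by (simp add: N_def c_def fun_eq_iff)
  show "Lp M (2 * (2 * q)) (hv k)"
    unfolding eq
    using Lq_norm_sum[OF p2(2), of "{..<k * K + L}" M "\<lambda>n \<omega>. (N n * c) *s cvec (y n \<omega> - \<mu>)"]
      Lp_centered_cvec[OF p2(2)] by blast
  have h: "(cmod (hfun L w s))\<^sup>2 \<le> real L"
  proof -
    have "(cmod (hfun L w s))\<^sup>2 \<le> (\<Sum>m<L. cmod (w s m) * 1)\<^sup>2"
      unfolding hfun_def by (intro power_mono) (auto intro: norm_sum)
    also have "\<dots> \<le> (\<Sum>m<L. (cmod (w s m))\<^sup>2) * (\<Sum>m<L. 1\<^sup>2)" by (rule Cauchy_Schwarz_ineq_sum)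
    finally show ?thesis by (simp add: weights)
  qed
  have total: "(\<Sum>n<k * K + L. N n) = real k * real L"
    using sum_windows[of "\<lambda>_. 1::real" K L k] by (simp add: N_def)
  have NB: "N n \<le> real B" "0 \<le> N n" for n
    using card_windows_le[OF K(1), of k n L] unfolding N_def by (simp_all only: of_nat_le_iff of_nat_0_le_iff)
  have "(\<Sum>n<k * K + L. (cmod (N n * c))\<^sup>2) = (cmod c)\<^sup>2 * (\<Sum>n<k * K + L. N n * N n)"
    unfolding sum_distrib_left by (intro sum.cong refl) (simp add: norm_mult power2_eq_square)
  also have "\<dots> \<le> (cmod c)\<^sup>2 * (\<Sum>n<k * K + L. real B * N n)"
    using NB by (intro mult_left_mono sum_mono mult_right_mono) auto
  also have "\<dots> = (cmod (hfun L w s))\<^sup>2 * (real B / (real k * real L))"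
    unfolding sum_distrib_left[symmetric] total c_def
    using k L by (simp add: norm_divide norm_mult power2_eq_square)
  also have "\<dots> \<le> real L * (real B / (real k * real L))"
    using h by (intro mult_right_mono) auto
  also have "\<dots> = real B / real k" using L by simp
  also have "\<dots> \<le> (real B)\<^sup>2 / real k"
    by (intro divide_right_mono) (auto simp: power2_eq_square)
  finally have "sqrt (\<Sum>n<k * K + L. (cmod (N n * c))\<^sup>2) \<le> real B / sqrt (real k)"
    using real_sqrt_le_mono by (fastforce simp: real_sqrt_divide)
  then have "C1 * sqrt (\<Sum>n<k * K + L. (cmod (N n * c))\<^sup>2) \<le> C1 * (real B / sqrt (real k))"
    using C1_nonneg by (rule mult_left_mono)
  also have "\<dots> = CC / sqrt (real k)" by (simp add: cc_def algebra_simps)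
  finally show "Lq_norm M (2 * (2 * q)) (hv k) \<le> CC / sqrt (real k)"
    unfolding eq using Lq_norm_weighted_sum_le_C1[where N = "k * K + L" and \<alpha> = "\<lambda>n. N n * c"] by linarith
qed

section \<open>Decomposition of the estimator and final estimate\<close>

lemma yhat_centered: "yhat K L w y i s \<omega> - hfun L w s *s cvec \<mu> = z i \<omega>"
  by (simp add: yhat_def hfun_def z_def cvec_def vec_eq_iff sum_component sum_distrib_right
      right_diff_distrib sum_subtractf)

text \<open>Each summand of the estimator is the outer product of
  \<open>z i \<omega> - hv k \<omega>\<close>, and \<open>hv k\<close> does not depend on
  \<open>i\<close>; so averaging the expansion moves the mean of the \<open>z i\<close> into the two
  cross terms.\<close>

lemma Phihat_minus_Phibar:
  assumes "1 \<le> k"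
  shows "Phihat K L w y k s \<omega> - Phibar M K L w y s
    = (1 / real k) *\<^sub>R (\<Sum>i<k. Z i \<omega>)
      - (outer2 ((1 / real k) *\<^sub>R (\<Sum>i<k. z i \<omega>)) (hv k \<omega>)
         + outer2 (hv k \<omega>) ((1 / real k) *\<^sub>R (\<Sum>i<k. z i \<omega>)))
      + outer2 (hv k \<omega>) (hv k \<omega>)"
proof -
  have "yhat K L w y i s \<omega> - hfun L w s *s cvec (muhat K L y k \<omega>) = z i \<omega> - hv k \<omega>" for i
    unfolding hv_def scale_cvec_diff[symmetric] yhat_centered[symmetric] by simp
  moreover have "Phibar M K L w y s = (\<integral>\<omega>. outer (z 0 \<omega>) \<partial>M)"
    by (simp add: Phibar_def yhat_centered)
  moreover have "(1 / real k) *\<^sub>R (\<Sum>i<k. c) = c" for c :: "complex ^ 'n ^ 'n"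
    using assms by (simp add: sum_constant_scaleR del: sum_constant)
  ultimately show ?thesis
    by (simp add: Phihat_def Z_def outer_of_diff outer2_sum_left outer2_sum_right outer_eq_outer2[of "hv k \<omega>"]
        sum.distrib sum_subtractf scaleR_right_diff_distrib scaleR_right_distrib del: sum_constant)
qed

text \<open>The average of the \<open>Z i\<close> and \<open>hv\<close> supply the decay
  \<open>1 / sqrt k\<close>; in the cross terms the averaged transform is merely bounded by
  \<open>C1\<close>, giving \<open>2 * C1 * CC\<close>. The quadratic term decays like
  \<open>1 / k\<close>, which \<open>k \<ge> 1\<close> weakens to \<open>1 / sqrt k\<close>.\<close>

theorem Lq_norm_Phihat_le:
  assumes k: "1 \<le> k"
  shows "Lp M (2 * q) (\<lambda>\<omega>. Phihat K L w y k s \<omega> - Phibar M K L w y s)"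
    and "Lq_norm M (2 * q) (\<lambda>\<omega>. Phihat K L w y k s \<omega> - Phibar M K L w y s)
      \<le> (4 * sqrt (6 * (2 * q - 1) * C1 ^ 3 * C2) + 2 * C1 * CC + CC\<^sup>2) / sqrt (real k)"
proof -
  let ?A = "4 * sqrt (6 * (2 * q - 1) * C1 ^ 3 * C2)"
  define zb where "zb \<omega> = (1 / real k) *\<^sub>R (\<Sum>i<k. z i \<omega>)" for \<omega>
  define Zb where "Zb \<omega> = (1 / real k) *\<^sub>R (\<Sum>i<k. Z i \<omega>)" for \<omega>
  have q0: "0 < 2 * q" using q by simp
  have sk: "0 < sqrt (real k)" "1 \<le> sqrt (real k)" "sqrt (real k) * sqrt (real k) = real k" using k by auto
  have zs: "Lp M (2 * (2 * q)) (\<lambda>\<omega>. \<Sum>i<k. z i \<omega>)" "Lq_norm M (2 * (2 * q)) (\<lambda>\<omega>. \<Sum>i<k. z i \<omega>) \<le> real k * C1"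
    using Lq_norm_sum[OF p2(2), of "{..<k}" M z] Lp_z sum_mono[of "{..<k}" "\<lambda>i. Lq_norm M (2 * (2 * q)) (z i)" "\<lambda>_. C1"]
      Lq_norm_z_le by auto
  have zb: "Lp M (2 * (2 * q)) zb" "Lq_norm M (2 * (2 * q)) zb \<le> C1"
  proof -
    have "(1 / real k) * Lq_norm M (2 * (2 * q)) (\<lambda>\<omega>. \<Sum>i<k. z i \<omega>) \<le> (1 / real k) * (real k * C1)"
      using zs(2) by (intro mult_left_mono) auto
    then show "Lp M (2 * (2 * q)) zb" "Lq_norm M (2 * (2 * q)) zb \<le> C1"
      using Lp_scaleR[OF p2(3) zs(1), of "1 / real k"] k by (auto simp: zb_def[abs_def])
  qed
  have Zs: "Lp M (2 * q) (\<lambda>\<omega>. \<Sum>i<k. Z i \<omega>)"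
    using Lq_norm_sum[OF p2(5), of "{..<k}" M Z] Lp_Z by auto
  have Zb: "Lp M (2 * q) Zb" "Lq_norm M (2 * q) Zb \<le> ?A / sqrt (real k)"
  proof -
    show "Lp M (2 * q) Zb" unfolding Zb_def[abs_def] by (rule Lp_scaleR(1)[OF q0 Zs])
    have "Lq_norm M (2 * q) Zb \<le> (1 / real k) * Lq_norm M (2 * q) (\<lambda>\<omega>. \<Sum>i<k. Z i \<omega>)"
      using Lp_scaleR(2)[OF q0 Zs, of "1 / real k"] by (simp add: Zb_def[abs_def])
    also have "\<dots> \<le> (1 / real k) * (?A * sqrt (real k))"
      by (intro mult_left_mono Lq_norm_sum_Z_le) simp
    also have "\<dots> = ?A / sqrt (real k)" using sk by (simp add: real_div_sqrt field_simps)
    finally show "Lq_norm M (2 * q) Zb \<le> ?A / sqrt (real k)" .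
  qed
  note hv = Lq_norm_hv_le[OF k]
  note o1 = Lp_outer2[OF p2(5) zb(1) hv(1)] and o2 = Lp_outer2[OF p2(5) hv(1) zb(1)]
    and o3 = Lp_outer2[OF p2(5) hv(1) hv(1)]
  note o12 = Lq_norm_triangle[OF p2(5) o1(1) o2(1)]
  note d = Lq_norm_diff[OF p2(5) Zb(1) o12(1)]
  note t = Lq_norm_triangle[OF p2(5) d(1) o3(1)]
  have eq: "(\<lambda>\<omega>. Phihat K L w y k s \<omega> - Phibar M K L w y s)
      = (\<lambda>\<omega>. Zb \<omega> - (outer2 (zb \<omega>) (hv k \<omega>) + outer2 (hv k \<omega>) (zb \<omega>)) + outer2 (hv k \<omega>) (hv k \<omega>))"
    by (simp add: Phihat_minus_Phibar[OF k] zb_def Zb_def)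
  show "Lp M (2 * q) (\<lambda>\<omega>. Phihat K L w y k s \<omega> - Phibar M K L w y s)"
    unfolding eq by (rule t)
  have zh: "Lq_norm M (2 * (2 * q)) zb * Lq_norm M (2 * (2 * q)) (hv k) \<le> C1 * (CC / sqrt (real k))"
    by (rule mult_mono[OF zb(2) hv(2) C1_nonneg Lq_norm_nonneg])
  have hh: "Lq_norm M (2 * (2 * q)) (hv k) * Lq_norm M (2 * (2 * q)) (hv k) \<le> CC\<^sup>2 / sqrt (real k)"
  proof -
    have "Lq_norm M (2 * (2 * q)) (hv k) * Lq_norm M (2 * (2 * q)) (hv k) \<le> (CC / sqrt (real k)) * (CC / sqrt (real k))"
      using CC_nonneg by (intro mult_mono hv) auto
    also have "\<dots> \<le> (CC / sqrt (real k)) * CC"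
      using CC_nonneg sk mult_left_mono[OF sk(2) CC_nonneg] by (intro mult_left_mono) (auto simp: divide_le_eq)
    finally show ?thesis by (simp add: power2_eq_square)
  qed
  have "Lq_norm M (2 * q) (\<lambda>\<omega>. Phihat K L w y k s \<omega> - Phibar M K L w y s)
      \<le> ?A / sqrt (real k) + 2 * (C1 * (CC / sqrt (real k))) + CC\<^sup>2 / sqrt (real k)"
    unfolding eq using t(2) d(2) o12(2) o1(2) o2(2) o3(2) Zb(2) zh hh by (simp add: mult.commute)
  then show "Lq_norm M (2 * q) (\<lambda>\<omega>. Phihat K L w y k s \<omega> - Phibar M K L w y s)
      \<le> (?A + 2 * C1 * CC + CC\<^sup>2) / sqrt (real k)"
    by (simp add: add_divide_distrib)
qed

end

theorem theorem2:
  fixes P :: "'a measure" and F Fp :: "nat \<Rightarrow> 'a measure"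
    and y :: "nat \<Rightarrow> 'a \<Rightarrow> real ^ 'n"
    and K M :: nat and w :: "real \<Rightarrow> nat \<Rightarrow> complex"
    and k :: nat and s q :: real
  assumes "prob_space P"
    and "filtration_pair P F Fp"
    and "stationary P y"
    and "L_mixing P F Fp y"
    and "1 \<le> K" and "K \<le> M"
    and "\<And>s. (\<Sum>j<M. (cmod (w s j))\<^sup>2) = 1"
    and "1 \<le> k" and "1 \<le> q"
  shows "integrable P (\<lambda>\<omega>. norm (Phihat K M w y k s \<omega> - Phibar P K M w y s) powr q) \<and>
    Lq_norm P q (\<lambda>\<omega>. Phihat K M w y k s \<omega> - Phibar P K M w y s)
      \<le> (4 * sqrt (6 * (2 * q - 1) * (c1 P Fp y (2 * q)) ^ 3 * c2 P Fp K M y (2 * q))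
          + 2 * c1 P Fp y (2 * q) * cc P Fp K M y (2 * q)
          + (cc P Fp K M y (2 * q))\<^sup>2) / sqrt (real k)"
proof -
  interpret prob_space P by fact
  interpret batch_estimator P F Fp y K M w s q
    using assms by unfold_locales auto
  note b = Lq_norm_Phihat_le[OF assms(8)]
  \<comment> \<open>From exponent \<open>2 * q\<close> back to \<open>q\<close>.\<close>
  note d = Lq_norm_double[OF assms(9) b(1)]
  show ?thesis using Lp_integrable[OF d(1)] order_trans[OF d(2) b(2)] by blast
qed

end
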